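(* The contact complex $\mathrm{Cont}^\triangle(X)$ of every quasi-median graph $X$ is contractible.
   Context: A quasi-median graph is a connected graph that is a retract of a Hamming graph (a product of complete graphs; for infinite products, a connected component of such a product). Equivalently: a connected graph containing no induced $K_{2,3}$ and no induced $K_4$ minus an edge, and satisfying the triangle condition (if $x,y$ are adjacent and $d(o,x)=d(o,y)=k\ge 1$, then $x,y$ have a common neighbour at distance $k-1$ from $o$) and the quadrangle condition (if $x,y$ are distinct non-adjacent neighbours of $z$ with $d(o,x)=d(o,y)=d(o,z)-1=k$, then $x,y$ have a common neighbour at distance $k-1$ from $o$). A hyperplane of $X$ is an equivalence class of edges for the reflexive-transitive closure of the relation identifying two edges that lie in a common $3$-cycle or are opposite in a $4$-cycle. Two distinct hyperplanes are in contact if there are an edge of the first and an edge of the second that share a vertex (equivalently, if their carriers, i.e. the subgraphs induced by their edges, intersect). The contact complex $\mathrm{Cont}^\triangle(X)$ is the simplicial complex whose vertices are the hyperplanes of $X$ and whose simplices are given by the (finite) collections of hyperplanes pairwise in contact. *)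

theory Defs
  imports "HOL-Analysis.Analysis"
begin

section \<open>Graphs\<close>

text \<open>
  A simple graph, possibly infinite, is given by its vertex set V and its set E of edges,
  each edge being a two-element set of vertices.
\<close>

definition simple_graph :: "'a set \<Rightarrow> 'a set set \<Rightarrow> bool" where
  "simple_graph V E \<longleftrightarrow> (\<forall>e\<in>E. \<exists>x\<in>V. \<exists>y\<in>V. x \<noteq> y \<and> e = {x, y})"

definition adj_rel :: "'a set set \<Rightarrow> ('a \<times> 'a) set" where
  "adj_rel E = {(x, y). {x, y} \<in> E}"

definition connected_graph :: "'a set \<Rightarrow> 'a set set \<Rightarrow> bool" where
  "connected_graph V E \<longleftrightarrow>
     simple_graph V E \<and> V \<noteq> {} \<and> (\<forall>x\<in>V. \<forall>y\<in>V. (x, y) \<in> (adj_rel E)\<^sup>*)"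

text \<open>The value of graph_dist is meaningful only for vertices joined by a walk.\<close>

definition graph_dist :: "'a set set \<Rightarrow> 'a \<Rightarrow> 'a \<Rightarrow> nat" where
  "graph_dist E x y = (LEAST n. (x, y) \<in> adj_rel E ^^ n)"


section \<open>Quasi-median graphs\<close>

definition has_induced_K23 :: "'a set \<Rightarrow> 'a set set \<Rightarrow> bool" where
  "has_induced_K23 V E \<longleftrightarrow>
     (\<exists>a\<in>V. \<exists>b\<in>V. \<exists>x\<in>V. \<exists>y\<in>V. \<exists>z\<in>V. distinct [a, b, x, y, z] \<and>
        {a, x} \<in> E \<and> {a, y} \<in> E \<and> {a, z} \<in> E \<and>
        {b, x} \<in> E \<and> {b, y} \<in> E \<and> {b, z} \<in> E \<and>
        {a, b} \<notin> E \<and> {x, y} \<notin> E \<and> {y, z} \<notin> E \<and> {x, z} \<notin> E)"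

definition has_induced_K4_minus_edge :: "'a set \<Rightarrow> 'a set set \<Rightarrow> bool" where
  "has_induced_K4_minus_edge V E \<longleftrightarrow>
     (\<exists>a\<in>V. \<exists>b\<in>V. \<exists>x\<in>V. \<exists>y\<in>V. distinct [a, b, x, y] \<and>
        {a, x} \<in> E \<and> {a, y} \<in> E \<and> {b, x} \<in> E \<and> {b, y} \<in> E \<and> {x, y} \<in> E \<and>
        {a, b} \<notin> E)"

definition triangle_condition :: "'a set \<Rightarrow> 'a set set \<Rightarrow> bool" where
  "triangle_condition V E \<longleftrightarrow>
     (\<forall>p\<in>V. \<forall>x\<in>V. \<forall>y\<in>V. \<forall>k\<ge>1.
        {x, y} \<in> E \<and> graph_dist E p x = k \<and> graph_dist E p y = k \<longrightarrow>
        (\<exists>w\<in>V. {x, w} \<in> E \<and> {y, w} \<in> E \<and> graph_dist E p w = k - 1))"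

text \<open>
  In the quadrangle condition the case k = 0 is vacuous (it would force x = p = y), so the
  truncated subtraction is harmless.
\<close>

definition quadrangle_condition :: "'a set \<Rightarrow> 'a set set \<Rightarrow> bool" where
  "quadrangle_condition V E \<longleftrightarrow>
     (\<forall>p\<in>V. \<forall>x\<in>V. \<forall>y\<in>V. \<forall>z\<in>V. \<forall>k.
        x \<noteq> y \<and> {x, y} \<notin> E \<and> {x, z} \<in> E \<and> {y, z} \<in> E \<and>
        graph_dist E p x = k \<and> graph_dist E p y = k \<and> graph_dist E p z = k + 1 \<longrightarrow>
        (\<exists>w\<in>V. {x, w} \<in> E \<and> {y, w} \<in> E \<and> graph_dist E p w = k - 1))"

definition quasi_median_graph :: "'a set \<Rightarrow> 'a set set \<Rightarrow> bool" where
  "quasi_median_graph V E \<longleftrightarrow>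
     connected_graph V E \<and> \<not> has_induced_K23 V E \<and> \<not> has_induced_K4_minus_edge V E \<and>
     triangle_condition V E \<and> quadrangle_condition V E"


section \<open>Hyperplanes and contact\<close>

definition in_common_triangle :: "'a set set \<Rightarrow> 'a set \<Rightarrow> 'a set \<Rightarrow> bool" where
  "in_common_triangle E e f \<longleftrightarrow>
     (\<exists>x y z. distinct [x, y, z] \<and> {{x, y}, {y, z}, {x, z}} \<subseteq> E \<and>
        e \<in> {{x, y}, {y, z}, {x, z}} \<and> f \<in> {{x, y}, {y, z}, {x, z}})"

definition opposite_in_square :: "'a set set \<Rightarrow> 'a set \<Rightarrow> 'a set \<Rightarrow> bool" where
  "opposite_in_square E e f \<longleftrightarrow>
     (\<exists>a b c d. distinct [a, b, c, d] \<and> {{a, b}, {b, c}, {c, d}, {d, a}} \<subseteq> E \<and>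
        e = {a, b} \<and> f = {c, d})"

definition hyperplane_rel :: "'a set set \<Rightarrow> ('a set \<times> 'a set) set" where
  "hyperplane_rel E = {(e, f). in_common_triangle E e f \<or> opposite_in_square E e f}\<^sup>*"

definition hyperplanes :: "'a set set \<Rightarrow> 'a set set set" where
  "hyperplanes E = E // hyperplane_rel E"

definition in_contact :: "'a set set \<Rightarrow> 'a set set \<Rightarrow> bool" where
  "in_contact H H' \<longleftrightarrow> H \<noteq> H' \<and> (\<exists>e\<in>H. \<exists>f\<in>H'. e \<inter> f \<noteq> {})"


section \<open>The contact complex and its geometric realization\<close>

text \<open>An abstract simplicial complex is given by the set of its nonempty simplices.\<close>

definition contact_complex :: "'a set set \<Rightarrow> 'a set set set set" where
  "contact_complex E =
     {S. S \<subseteq> hyperplanes E \<and> finite S \<and> S \<noteq> {} \<and>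
         (\<forall>H\<in>S. \<forall>H'\<in>S. H \<noteq> H' \<longrightarrow> in_contact H H')}"

text \<open>
  Points of a realization are functions giving barycentric coordinates, extended by 0 outside
  the simplex. The restriction of the product topology to the closed simplex spanned by a
  finite set is its usual Euclidean topology.
\<close>

definition closed_simplex :: "'v set \<Rightarrow> ('v \<Rightarrow> real) set" where
  "closed_simplex S = {t. (\<forall>v. 0 \<le> t v) \<and> (\<forall>v. v \<notin> S \<longrightarrow> t v = 0) \<and> sum t S = 1}"

text \<open>The weak (CW) topology: a set is open iff its trace on every closed simplex is.\<close>

definition geometric_realization :: "'v set set \<Rightarrow> ('v \<Rightarrow> real) topology" where
  "geometric_realization K =
     topology (\<lambda>U. U \<subseteq> (\<Union>S\<in>K. closed_simplex S) \<and>
       (\<forall>S\<in>K. openin (subtopology (powertop_real UNIV) (closed_simplex S))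
                (U \<inter> closed_simplex S)))"

lemma openin_geometric_realization:
  "openin (geometric_realization K) U \<longleftrightarrow>
     U \<subseteq> (\<Union>S\<in>K. closed_simplex S) \<and>
     (\<forall>S\<in>K. openin (subtopology (powertop_real UNIV) (closed_simplex S))
              (U \<inter> closed_simplex S))"
proof -
  let ?X = "\<lambda>S. subtopology (powertop_real UNIV) (closed_simplex S)"
  let ?L = "\<lambda>U. U \<subseteq> (\<Union>S\<in>K. closed_simplex S) \<and> (\<forall>S\<in>K. openin (?X S) (U \<inter> closed_simplex S))"
  have "istopology ?L"
    unfolding istopology_def
  proof (intro conjI allI impI)
    fix A B assume AB: "?L A" "?L B"
    then show "A \<inter> B \<subseteq> (\<Union>S\<in>K. closed_simplex S)" by blast
    have "openin (?X S) ((A \<inter> B) \<inter> closed_simplex S)" if "S \<in> K" for S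
    proof -
      have "openin (?X S) ((A \<inter> closed_simplex S) \<inter> (B \<inter> closed_simplex S))"
        by (rule openin_Int) (use AB that in blast)+
      moreover have "(A \<inter> closed_simplex S) \<inter> (B \<inter> closed_simplex S) = (A \<inter> B) \<inter> closed_simplex S"
        by blast
      ultimately show ?thesis by simp
    qed
    then show "\<forall>S\<in>K. openin (?X S) ((A \<inter> B) \<inter> closed_simplex S)" by blast
  next
    fix \<A> assume \<A>: "\<forall>A\<in>\<A>. ?L A"
    then show "\<Union>\<A> \<subseteq> (\<Union>S\<in>K. closed_simplex S)" by blast
    have "openin (?X S) (\<Union>\<A> \<inter> closed_simplex S)" if "S \<in> K" for S
    proof -
      have "openin (?X S) (\<Union>A\<in>\<A>. A \<inter> closed_simplex S)"
        by (rule openin_Union) (use \<A> that in blast)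
      moreover have "(\<Union>A\<in>\<A>. A \<inter> closed_simplex S) = \<Union>\<A> \<inter> closed_simplex S"
        by blast
      ultimately show ?thesis by simp
    qed
    then show "\<forall>S\<in>K. openin (?X S) (\<Union>\<A> \<inter> closed_simplex S)" by blast
  qed
  from topology_inverse'[OF this] show ?thesis
    unfolding geometric_realization_def by simp
qed

lemma topspace_geometric_realization:
  "topspace (geometric_realization K) = (\<Union>S\<in>K. closed_simplex S)"
proof
  show "topspace (geometric_realization K) \<subseteq> (\<Union>S\<in>K. closed_simplex S)"
    by (metis openin_geometric_realization openin_topspace)
next
  have "openin (subtopology (powertop_real UNIV) (closed_simplex S))
          ((\<Union>S\<in>K. closed_simplex S) \<inter> closed_simplex S)" if "S \<in> K" for S
  proof -
    have "(\<Union>S\<in>K. closed_simplex S) \<inter> closed_simplex S = closed_simplex S"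
      using that by blast
    moreover have "topspace (subtopology (powertop_real UNIV) (closed_simplex S)) = closed_simplex S"
      by simp
    ultimately show ?thesis by (metis openin_topspace)
  qed
  then show "(\<Union>S\<in>K. closed_simplex S) \<subseteq> topspace (geometric_realization K)"
    by (intro openin_subset) (simp add: openin_geometric_realization)
qed

end

(*
Fix a vertex o lying on an edge and filter the contact complex by K_n, the simplices all of whose
hyperplanes have an edge at one common vertex x with d(o, x) <= n. Carriers of hyperplanes are
gated, hence have the Helly property, and the K_n exhaust the contact complex. Passing from
K_(n-1) to K_n attaches, for every x with d(o, x) = n, the full (possibly infinite) simplex H(x)
spanned by the hyperplanes at x. If q is a neighbour of x closer to o, then H(x) is attached along
a cone whose apex is the hyperplane of {x, q}: a simplex of H(x) that is also seen from another
vertex at most as far from o is seen from some closer neighbour q' of x (gatedness), and so is the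
apex (quadrangle condition). A simplex retracts onto any subcomplex that is a cone, so a
contraction of K_(n-1) extends to K_n, and the extensions agree on the union.

Carriers are convex because a hyperplane J through an edge of a maximal clique C contains only
edges whose two ends have different gates in C.
*)
theory Submission
  imports Defs
begin

section \<open>The weak topology\<close>

text \<open>The retraction onto a cone is given by a formula: every coordinate except that of the
  apex \<open>a\<close> sinks at unit speed down to 0, and \<open>a\<close> collects the lost mass.
  The other vertices still above 0 at time \<open>s\<close> are those whose coordinate exceeds
  \<open>s\<close>; the time after which they span a simplex of \<open>L\<close> (or none is left)
  is a maximum of minima of coordinates, hence continuous. The formula does not mention an ambient
  simplex, so it serves all finite faces of an infinite H(x) at once.

  The infinite filtration is the obstacle. Spending a fixed part of the time interval on the flow
  would reparametrize the old contraction at every stage, and the extensions would not agree. The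
  time spent is therefore proportional to the threshold, which vanishes on \<open>L\<close>, so the
  old contraction is extended without any change.

  In the convexity of carriers the delicate case is an edge {x, v} of J with v farther than x from
  the carrier vertex y. Then y is the gate of x in a clique at y, and from the gate z of v in that
  clique it is v that is closer, so the quadrangle condition can be used from z.\<close>

lemma powertop_real_eq_euclidean: "powertop_real UNIV = (euclidean :: ('v \<Rightarrow> real) topology)"
  by (simp add: euclidean_product_topology)

lemma closed_closed_simplex: "closed (closed_simplex S)"
proof -
  have "closed_simplex S = (\<Inter>v. {t. 0 \<le> t v}) \<inter> (\<Inter>v\<in>-S. {t. t v = 0}) \<inter> {t. sum t S = 1}"
    by (auto simp: closed_simplex_def)
  moreover have "closed {t. 0 \<le> (t v :: real)}" "closed {t. t v = (0::real)}" for v :: 'a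
    using closed_Collect_le[of "\<lambda>_. 0" "\<lambda>t. t v"] closed_Collect_eq[of "\<lambda>t. t v" "\<lambda>_. 0"] by simp_all
  moreover have "closed {t :: 'a \<Rightarrow> real. sum t S = 1}"
    by (intro closed_Collect_eq continuous_on_const continuous_on_sum continuous_on_product_coordinates)
  ultimately show ?thesis
    by (auto intro!: closed_INT closed_Int)
qed

lemma closedin_geometric_realization:
  "closedin (geometric_realization K) C \<longleftrightarrow>
     C \<subseteq> (\<Union>S\<in>K. closed_simplex S) \<and> (\<forall>S\<in>K. closed (C \<inter> closed_simplex S))"
proof -
  have "openin (top_of_set (closed_simplex S)) ((\<Union>(closed_simplex ` K) - C) \<inter> closed_simplex S)
      \<longleftrightarrow> closed (C \<inter> closed_simplex S)" if "S \<in> K" for S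
  proof -
    have "(\<Union>(closed_simplex ` K) - C) \<inter> closed_simplex S
        = closed_simplex S - C \<inter> closed_simplex S"
      using that by blast
    then have "openin (top_of_set (closed_simplex S)) ((\<Union>(closed_simplex ` K) - C) \<inter> closed_simplex S)
        \<longleftrightarrow> closedin (top_of_set (closed_simplex S)) (C \<inter> closed_simplex S)"
      by (simp add: closedin_def)
    also have "\<dots> \<longleftrightarrow> closed (C \<inter> closed_simplex S)"
      using closed_closed_simplex closedin_closed_eq by blast
    finally show ?thesis .
  qed
  then show ?thesis
    unfolding closedin_def topspace_geometric_realization openin_geometric_realization
      powertop_real_eq_euclidean by auto
qed

text \<open>The weak topology can be finer than the product topology. When finitely many simplices
  suffice, the preimage of a closed set is a finite union of preimages of sets closed in the product
  topology, so the difference disappears.\<close>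

lemma continuous_map_into_realization:
  fixes f :: "'b \<Rightarrow> 'v \<Rightarrow> real"
  assumes "finite F" "F \<subseteq> K" and f: "continuous_map Y euclidean f"
    and im: "\<And>y. y \<in> topspace Y \<Longrightarrow> \<exists>T\<in>F. f y \<in> closed_simplex T"
  shows "continuous_map Y (geometric_realization K) f"
  unfolding continuous_map_closedin topspace_geometric_realization
proof (intro conjI ballI allI impI Pi_I)
  fix y assume "y \<in> topspace Y"
  then show "f y \<in> (\<Union>S\<in>K. closed_simplex S)"
    using im \<open>F \<subseteq> K\<close> by blast
next
  fix C assume C: "closedin (geometric_realization K) C"
  have "{y \<in> topspace Y. f y \<in> C} = (\<Union>T\<in>F. {y \<in> topspace Y. f y \<in> C \<inter> closed_simplex T})"
    using im by blast
  moreover have "closedin Y {y \<in> topspace Y. f y \<in> C \<inter> closed_simplex T}" if "T \<in> F" for T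
  proof -
    have "closed (C \<inter> closed_simplex T)"
      using C that \<open>F \<subseteq> K\<close> by (auto simp: closedin_geometric_realization)
    then show ?thesis
      using closedin_continuous_map_preimage[OF f] by (metis closed_closedin)
  qed
  ultimately show "closedin Y {y \<in> topspace Y. f y \<in> C}"
    using closedin_Union[of "(\<lambda>T. {y \<in> topspace Y. f y \<in> C \<inter> closed_simplex T}) ` F" Y] \<open>finite F\<close>
    by (metis (no_types, lifting) finite_imageI imageE)
qed

lemma continuous_map_realization_mono:
  assumes "L \<subseteq> K"
  shows "continuous_map (geometric_realization L) (geometric_realization K) (\<lambda>t. t)"
  unfolding continuous_map_closedin topspace_geometric_realization
proof (intro conjI ballI allI impI)
  fix C assume "closedin (geometric_realization K) C"
  then have "closed (C \<inter> closed_simplex S)" if "S \<in> L" for S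
    using that assms by (auto simp: closedin_geometric_realization)
  moreover have "{t \<in> \<Union>(closed_simplex ` L). t \<in> C} \<inter> closed_simplex S = C \<inter> closed_simplex S"
    if "S \<in> L" for S using that by blast
  ultimately show "closedin (geometric_realization L) {t \<in> \<Union>(closed_simplex ` L). t \<in> C}"
    by (auto simp: closedin_geometric_realization)
qed (use assms in auto)

text \<open>Compactness of the neighbourhoods in the interval (a tube-lemma argument) is what makes the
  product of the weak topology with the interval again weak.\<close>

lemma continuous_map_homotopy_realization:
  assumes h: "\<And>S. S \<in> K \<Longrightarrow> continuous_map (top_of_set ({0..1::real} \<times> closed_simplex S)) Z h"
  shows "continuous_map (prod_topology (top_of_set {0..1}) (geometric_realization K)) Z h"
  unfolding continuous_map_def
proof (intro conjI allI impI Pi_I)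
  fix p assume "p \<in> topspace (prod_topology (top_of_set {0..1::real}) (geometric_realization K))"
  then obtain S where "S \<in> K" "p \<in> {0..1} \<times> closed_simplex S"
    by (auto simp: topspace_geometric_realization)
  then show "h p \<in> topspace Z"
    using h by (fastforce simp: continuous_map_def)
next
  fix W assume W: "openin Z W"
  let ?U = "{p \<in> topspace (prod_topology (top_of_set {0..1::real}) (geometric_realization K)). h p \<in> W}"
  show "openin (prod_topology (top_of_set {0..1::real}) (geometric_realization K)) ?U"
    unfolding openin_prod_topology_alt
  proof (intro allI impI)
    fix \<tau> t assume "(\<tau>, t) \<in> ?U"
    then obtain S where S: "S \<in> K" "t \<in> closed_simplex S" and \<tau>: "\<tau> \<in> {0..1}" and hW: "h (\<tau>, t) \<in> W"
      by (auto simp: topspace_geometric_realization)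
    have "continuous_map (top_of_set {0..1}) (top_of_set ({0..1::real} \<times> closed_simplex S)) (\<lambda>\<tau>. (\<tau>, t))"
      using S by (auto simp: continuous_map_in_subtopology continuous_on_Pair)
    then have "continuous_map (top_of_set {0..1}) Z (h \<circ> (\<lambda>\<tau>. (\<tau>, t)))"
      using h[OF \<open>S \<in> K\<close>] continuous_map_compose by blast
    then have "openin (top_of_set {0..1}) {x \<in> {0..1::real}. h (x, t) \<in> W}"
      using W by (simp add: continuous_map_def)
    then obtain e where e: "e > 0" "cball \<tau> e \<inter> {0..1} \<subseteq> {x \<in> {0..1}. h (x, t) \<in> W}"
      using \<tau> hW unfolding openin_contains_cball by auto
    define N where "N = cball \<tau> e \<inter> {0..1}"
    have N: "compact N" "N \<subseteq> {0..1}"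
      by (auto simp: N_def compact_Int)
    define Q where "Q = {s \<in> \<Union>(closed_simplex ` K). \<forall>x\<in>N. h (x, s) \<in> W}"
    have "openin (geometric_realization K) Q"
      unfolding openin_geometric_realization powertop_real_eq_euclidean
    proof (intro conjI ballI)
      fix S assume S: "S \<in> K"
      have "continuous_map (top_of_set (N \<times> closed_simplex S)) Z h"
        using continuous_map_from_subtopology_mono[OF h[OF S]] N(2) by (simp add: Sigma_mono)
      then have "closedin (top_of_set (N \<times> closed_simplex S))
          {p \<in> N \<times> closed_simplex S. h p \<in> topspace Z - W}"
        using closedin_continuous_map_preimage[of "top_of_set (N \<times> closed_simplex S)" Z h "topspace Z - W"] W
        by (metis (no_types, lifting) Collect_cong closedin_diff closedin_topspace topspace_euclidean_subtopology)
      \<comment> \<open>Projection along the compact factor \<open>N\<close> is closed, so the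
        points that leave \<open>W\<close> at some time in \<open>N\<close> form a closed set;
        \<open>Q\<close> is its complement on each simplex.\<close>
      moreover have "closed_map (prod_topology (top_of_set N) (top_of_set (closed_simplex S)))
          (top_of_set (closed_simplex S)) snd"
        using N by (intro Abstract_Topological_Spaces.closed_map_snd) (simp add: compact_space_subtopology)
      ultimately have "closedin (top_of_set (closed_simplex S))
          (snd ` {p \<in> N \<times> closed_simplex S. h p \<in> topspace Z - W})"
        unfolding prod_topology_subtopology_eu closed_map_def by blast
      moreover have "closed_simplex S - snd ` {p \<in> N \<times> closed_simplex S. h p \<in> topspace Z - W}
          = Q \<inter> closed_simplex S"
      proof -
        have "h (x, s) \<in> topspace Z" if "x \<in> N" "s \<in> closed_simplex S" for x s
          using h[OF S] N(2) that unfolding continuous_map_def by auto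
        then show ?thesis
          using S by (force simp: Q_def)
      qed
      ultimately show "openin (top_of_set (closed_simplex S)) (Q \<inter> closed_simplex S)"
        unfolding closedin_def by simp
    qed (auto simp: Q_def)
    moreover have "openin (top_of_set {0..1}) (ball \<tau> e \<inter> {0..1})"
      by (metis inf_commute open_ball openin_open_Int)
    moreover have "t \<in> Q"
      using S e by (auto simp: Q_def N_def)
    moreover have "\<tau> \<in> ball \<tau> e \<inter> {0..1}"
      using \<tau> \<open>e > 0\<close> by simp
    moreover have "(ball \<tau> e \<inter> {0..1}) \<times> Q \<subseteq> ?U"
      by (auto simp: Q_def N_def topspace_geometric_realization)
    ultimately show "\<exists>U V. openin (top_of_set {0..1}) U \<and> openin (geometric_realization K) V \<and>
        \<tau> \<in> U \<and> t \<in> V \<and> U \<times> V \<subseteq> ?U"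
      by blast
  qed
qed

section \<open>Attaching simplices along cones\<close>

definition vertex_point :: "'v \<Rightarrow> 'v \<Rightarrow> real" where
  "vertex_point c = (\<lambda>v. if v = c then 1 else 0)"

definition contraction :: "'v set set \<Rightarrow> ('v \<Rightarrow> real) \<Rightarrow> (real \<times> ('v \<Rightarrow> real) \<Rightarrow> 'v \<Rightarrow> real) \<Rightarrow> bool" where
  "contraction K c h \<longleftrightarrow>
     continuous_map (prod_topology (top_of_set {0..1}) (geometric_realization K)) (geometric_realization K) h \<and>
     (\<forall>t \<in> \<Union>(closed_simplex ` K). h (0, t) = t \<and> h (1, t) = c)"

definition abstract_complex :: "'v set set \<Rightarrow> bool" where
  "abstract_complex K \<longleftrightarrow>
     (\<forall>\<sigma>\<in>K. finite \<sigma> \<and> \<sigma> \<noteq> {} \<and> (\<forall>\<rho>. \<rho> \<subseteq> \<sigma> \<longrightarrow> \<rho> \<noteq> {} \<longrightarrow> \<rho> \<in> K))"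

definition supp :: "('v \<Rightarrow> real) \<Rightarrow> 'v set" where
  "supp t = {v. t v \<noteq> 0}"

lemma closed_simplexD:
  assumes "t \<in> closed_simplex S"
  shows "0 \<le> t v" "v \<notin> S \<Longrightarrow> t v = 0" "sum t S = 1" "finite S" "supp t \<subseteq> S" "supp t \<noteq> {}"
proof -
  show *: "0 \<le> t v" "v \<notin> S \<Longrightarrow> t v = 0" "sum t S = 1"
    using assms by (auto simp: closed_simplex_def)
  \<comment> \<open>A sum over an infinite set is 0 by convention, so total mass 1 forces
    finiteness.\<close>
  show "finite S"
    using * by (metis sum.infinite zero_neq_one)
  show "supp t \<subseteq> S"
    using assms by (auto simp: closed_simplex_def supp_def)
  show "supp t \<noteq> {}"
  proof
    assume "supp t = {}"
    then have "sum t S = 0"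
      by (auto simp: supp_def intro: sum.neutral)
    with * show False by simp
  qed
qed

lemma closed_simplex_supp:
  assumes "t \<in> closed_simplex S"
  shows "t \<in> closed_simplex (supp t)"
proof -
  note t = closed_simplexD[OF assms]
  have "sum t (supp t) = sum t S"
    using t(4,5) by (intro sum.mono_neutral_left) (auto simp: supp_def)
  then show ?thesis
    using t(1,3) by (simp add: closed_simplex_def supp_def)
qed

lemma closed_simplex_mono:
  assumes "t \<in> closed_simplex S" "S \<subseteq> T" "finite T"
  shows "t \<in> closed_simplex T"
proof -
  have "sum t T = sum t S"
    using assms closed_simplexD[OF assms(1)] by (intro sum.mono_neutral_right) auto
  then show ?thesis
    using assms by (auto simp: closed_simplex_def)
qed

text \<open>Membership in a subcomplex is decided by the support alone; this is what allows
  homotopies to be defined by cases on \<open>supp t\<close>.\<close>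

lemma in_realization_iff:
  assumes "abstract_complex K" "t \<in> closed_simplex S"
  shows "t \<in> \<Union>(closed_simplex ` K) \<longleftrightarrow> supp t \<in> K"
proof
  assume "t \<in> \<Union>(closed_simplex ` K)"
  then obtain S where S: "S \<in> K" "t \<in> closed_simplex S" by blast
  show "supp t \<in> K"
    using closed_simplexD(5,6)[OF S(2)] S(1) assms(1) unfolding abstract_complex_def by blast
next
  assume "supp t \<in> K"
  then show "t \<in> \<Union>(closed_simplex ` K)"
    using closed_simplex_supp[OF assms(2)] by blast
qed

lemma contractible_realizationI:
  assumes "contraction K c h"
  shows "contractible_space (geometric_realization K)"
proof -
  have "homotopic_with (\<lambda>x. True) (geometric_realization K) (geometric_realization K) id (\<lambda>x. c)"
    using assms unfolding contraction_def
    by (subst homotopic_with) (auto simp: topspace_geometric_realization)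
  then show ?thesis
    unfolding contractible_space_def by blast
qed

section \<open>Retracting a simplex onto a cone\<close>

definition cone_flow :: "'v \<Rightarrow> real \<Rightarrow> ('v \<Rightarrow> real) \<Rightarrow> 'v \<Rightarrow> real" where
  "cone_flow a s t =
     (\<lambda>v. if v = a then 1 - (\<Sum>w \<in> supp t - {a}. max (t w - s) 0) else max (t v - s) 0)"

text \<open>The first time at which the flow reaches \<open>L\<close>, provided that \<open>L\<close> is a cone with apex \<open>a\<close>.\<close>

definition threshold :: "'v set set \<Rightarrow> 'v \<Rightarrow> ('v \<Rightarrow> real) \<Rightarrow> real" where
  "threshold L a t = Max (insert 0 {Min (t ` \<sigma>) |\<sigma>. finite \<sigma> \<and> \<sigma> \<noteq> {} \<and> a \<notin> \<sigma> \<and> \<sigma> \<notin> L})"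

text \<open>Summing over the support makes the definition the same on all simplices containing
  \<open>t\<close>; summing over a fixed \<open>S\<close> makes continuity on that simplex
  visible.\<close>

lemma cone_flow_alt:
  assumes "t \<in> closed_simplex S" "0 \<le> s"
  shows "cone_flow a s t =
     (\<lambda>v. if v = a then 1 - (\<Sum>w \<in> S - {a}. max (t w - s) 0) else max (t v - s) 0)"
proof -
  have "(\<Sum>w \<in> supp t - {a}. max (t w - s) 0) = (\<Sum>w \<in> S - {a}. max (t w - s) 0)"
    using closed_simplexD[OF assms(1)] assms(2)
    by (intro sum.mono_neutral_left) (auto simp: supp_def)
  then show ?thesis
    by (simp only: cone_flow_def)
qed

lemma cone_flow_in_simplex:
  assumes t: "t \<in> closed_simplex S" and s: "0 \<le> s"
  shows "cone_flow a s t \<in> closed_simplex (insert a S)"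
proof -
  have "(\<Sum>w \<in> S - {a}. max (t w - s) 0) \<le> (\<Sum>w \<in> S - {a}. t w)"
    using closed_simplexD(1)[OF t] s by (intro sum_mono) auto
  also have "\<dots> \<le> sum t S"
    using closed_simplexD[OF t] by (intro sum_mono2) auto
  finally have "(\<Sum>w \<in> S - {a}. max (t w - s) 0) \<le> 1"
    using closed_simplexD(3)[OF t] by simp
  moreover have "sum (cone_flow a s t) (insert a S) = 1"
  proof -
    have "sum (cone_flow a s t) (S - {a}) = (\<Sum>w \<in> S - {a}. max (t w - s) 0)"
      by (intro sum.cong) (auto simp: cone_flow_def)
    then show ?thesis
      using closed_simplexD(4)[OF t] by (simp add: sum.insert_remove cone_flow_alt[OF t s])
  qed
  ultimately show ?thesis
    using closed_simplexD(2)[OF t] s unfolding closed_simplex_def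
    by (auto simp: cone_flow_alt[OF t s])
qed

lemma cone_flow_0:
  assumes t: "t \<in> closed_simplex S"
  shows "cone_flow a 0 t = t"
proof
  fix v
  have "max (t w - 0) 0 = t w" for w
    using closed_simplexD(1)[OF t, of w] by simp
  moreover have "1 - sum t (S - {a}) = t a"
    using closed_simplexD(2)[OF t, of a] closed_simplexD(3,4)[OF t] by (cases "a \<in> S") (auto simp: sum.remove)
  ultimately show "cone_flow a 0 t v = t v"
    using cone_flow_alt[OF t order_refl, of a] by simp
qed

lemma continuous_on_Max_insert:
  assumes "finite F" "\<And>i. i \<in> F \<Longrightarrow> continuous_on A (f i)"
  shows "continuous_on A (\<lambda>t. Max (insert (0::real) ((\<lambda>i. f i t) ` F)))"
  using assms
proof (induction F rule: finite_induct)
  case (insert i F)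
  have "Max (insert 0 ((\<lambda>i. f i t) ` insert i F)) = max (f i t) (Max (insert 0 ((\<lambda>i. f i t) ` F)))" for t
  proof -
    have "insert 0 ((\<lambda>i. f i t) ` insert i F) = insert (f i t) (insert 0 ((\<lambda>i. f i t) ` F))"
      by auto
    then show ?thesis
      using insert.hyps by (metis Max_insert finite.insertI finite_imageI insert_not_empty)
  qed
  moreover have "continuous_on A (\<lambda>t. max (f i t) (Max (insert 0 ((\<lambda>i. f i t) ` F))))"
    using insert by (intro continuous_on_max) auto
  ultimately show ?case by simp
qed simp

lemma continuous_on_Min_coordinates:
  assumes "finite \<sigma>" "\<sigma> \<noteq> {}"
  shows "continuous_on A (\<lambda>t :: 'v \<Rightarrow> real. Min (t ` \<sigma>))"
proof -
  have coord: "continuous_on A (\<lambda>t :: 'v \<Rightarrow> real. t i)" for i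
    by (rule continuous_on_subset[OF continuous_on_product_coordinates]) simp
  show ?thesis
    using assms
  proof (induction \<sigma> rule: finite_ne_induct)
    case (insert i F)
    have "continuous_on A (\<lambda>t. min (t i) (Min (t ` F)))"
      using insert coord by (intro continuous_on_min) auto
    moreover have "Min (t ` insert i F) = min (t i) (Min (t ` F))" for t :: "_ \<Rightarrow> real"
      using insert by simp
    ultimately show ?case by simp
  qed (simp add: coord)
qed

text \<open>A set that is not contained in \<open>S\<close> has a vertex with coordinate 0, so its
  minimum is 0 and is absorbed by \<open>insert 0\<close>. What remains is a fixed finite family,
  which gives continuity on the simplex.\<close>

lemma threshold_alt:
  assumes t: "t \<in> closed_simplex S"
  shows "threshold L a t =
    Max (insert 0 ((\<lambda>\<sigma>. Min (t ` \<sigma>)) ` {\<sigma>. \<sigma> \<subseteq> S \<and> \<sigma> \<noteq> {} \<and> a \<notin> \<sigma> \<and> \<sigma> \<notin> L}))"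
proof -
  have "Min (t ` \<sigma>) = 0" if \<sigma>: "finite \<sigma>" "\<sigma> \<noteq> {}" "\<not> \<sigma> \<subseteq> S" for \<sigma>
  proof (rule Min_eqI)
    obtain v where "v \<in> \<sigma>" "v \<notin> S" using \<sigma> by blast
    then show "0 \<in> t ` \<sigma>"
      using closed_simplexD(2)[OF t] by (metis imageI)
  qed (use closed_simplexD(1)[OF t] \<sigma> in auto)
  moreover have "finite \<sigma>" if "\<sigma> \<subseteq> S" for \<sigma>
    using closed_simplexD(4)[OF t] that finite_subset by blast
  ultimately have *: "\<sigma> \<subseteq> S \<longrightarrow> finite \<sigma>" "finite \<sigma> \<and> \<sigma> \<noteq> {} \<longrightarrow> Min (t ` \<sigma>) = 0 \<or> \<sigma> \<subseteq> S" for \<sigma>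
    by blast+
  let ?A = "{Min (t ` \<sigma>) |\<sigma>. finite \<sigma> \<and> \<sigma> \<noteq> {} \<and> a \<notin> \<sigma> \<and> \<sigma> \<notin> L}"
  let ?B = "(\<lambda>\<sigma>. Min (t ` \<sigma>)) ` {\<sigma>. \<sigma> \<subseteq> S \<and> \<sigma> \<noteq> {} \<and> a \<notin> \<sigma> \<and> \<sigma> \<notin> L}"
  have "r \<in> insert 0 ?B" if "r \<in> ?A" for r
  proof -
    from that obtain \<sigma> where \<sigma>: "r = Min (t ` \<sigma>)" "finite \<sigma>" "\<sigma> \<noteq> {}" "a \<notin> \<sigma>" "\<sigma> \<notin> L"
      by blast
    show ?thesis
    proof (cases "\<sigma> \<subseteq> S")
      case True
      then show ?thesis using \<sigma> by blast
    next
      case False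
      then have "r = 0" using \<sigma> *[of \<sigma>] by simp
      then show ?thesis by simp
    qed
  qed
  moreover have "r \<in> ?A" if "r \<in> ?B" for r
  proof -
    from that obtain \<sigma> where "r = Min (t ` \<sigma>)" "\<sigma> \<subseteq> S" "\<sigma> \<noteq> {}" "a \<notin> \<sigma>" "\<sigma> \<notin> L"
      by blast
    with * show ?thesis by blast
  qed
  ultimately have "insert 0 ?A = insert 0 ?B"
    by (intro equalityI subsetI; elim insertE) simp_all
  then show ?thesis
    by (simp add: threshold_def)
qed

lemma continuous_on_threshold: "continuous_on (closed_simplex S) (threshold L a)"
proof (cases "finite S")
  case True
  let ?F = "{\<sigma>. \<sigma> \<subseteq> S \<and> \<sigma> \<noteq> {} \<and> a \<notin> \<sigma> \<and> \<sigma> \<notin> L}"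
  have "continuous_on (closed_simplex S) (\<lambda>t. Max (insert 0 ((\<lambda>\<sigma>. Min (t ` \<sigma>)) ` ?F)))"
    using True by (intro continuous_on_Max_insert continuous_on_Min_coordinates) (auto intro: finite_subset)
  then show ?thesis
    by (subst continuous_on_cong[OF refl threshold_alt])
next
  case False
  then have "closed_simplex S = {}"
    using closed_simplexD(4) by blast
  then show ?thesis by simp
qed

lemma
  assumes t: "t \<in> closed_simplex S"
  shows threshold_nonneg: "0 \<le> threshold L a t"
    and threshold_le_1: "threshold L a t \<le> 1"
    and Min_le_threshold: "finite \<sigma> \<Longrightarrow> \<sigma> \<noteq> {} \<Longrightarrow> a \<notin> \<sigma> \<Longrightarrow> \<sigma> \<notin> L \<Longrightarrow> \<sigma> \<subseteq> S \<Longrightarrow> Min (t ` \<sigma>) \<le> threshold L a t"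
proof -
  let ?F = "{\<sigma>. \<sigma> \<subseteq> S \<and> \<sigma> \<noteq> {} \<and> a \<notin> \<sigma> \<and> \<sigma> \<notin> L}"
  have fin: "finite S" "finite ?F"
    using closed_simplexD(4)[OF t] by auto
  show "0 \<le> threshold L a t"
    unfolding threshold_alt[OF t] using fin by (intro Max_ge) auto
  show "finite \<sigma> \<Longrightarrow> \<sigma> \<noteq> {} \<Longrightarrow> a \<notin> \<sigma> \<Longrightarrow> \<sigma> \<notin> L \<Longrightarrow> \<sigma> \<subseteq> S \<Longrightarrow> Min (t ` \<sigma>) \<le> threshold L a t"
    unfolding threshold_alt[OF t] using fin by (intro Max_ge) auto
  have "t v \<le> 1" if "v \<in> S" for v
    using member_le_sum[OF that, of t] closed_simplexD(1,3,4)[OF t] by simp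
  then have "Min (t ` \<sigma>) \<le> 1" if "\<sigma> \<in> ?F" for \<sigma>
  proof -
    obtain v where "v \<in> \<sigma>" using \<open>\<sigma> \<in> ?F\<close> by blast
    from \<open>v \<in> \<sigma>\<close> have "Min (t ` \<sigma>) \<le> t v"
      using that finite_subset[OF _ fin(1)] by (intro Min_le) auto
    also have "t v \<le> 1"
      using \<open>v \<in> \<sigma>\<close> that \<open>\<And>v. v \<in> S \<Longrightarrow> t v \<le> 1\<close> by blast
    finally show ?thesis .
  qed
  then show "threshold L a t \<le> 1"
    unfolding threshold_alt[OF t] using fin by (intro Max.boundedI) auto
qed

text \<open>Computed inside the face spanned by the support, the maximum ranges over no set at all,
  because every nonempty subset of the support lies in \<open>L\<close>.\<close>

lemma threshold_eq_0:
  assumes L: "abstract_complex L" and t: "t \<in> closed_simplex S" and "supp t \<in> L"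
  shows "threshold L a t = 0"
proof -
  have t': "t \<in> closed_simplex (supp t)"
    using closed_simplex_supp[OF t] .
  have empty: "{\<sigma>. \<sigma> \<subseteq> supp t \<and> \<sigma> \<noteq> {} \<and> a \<notin> \<sigma> \<and> \<sigma> \<notin> L} = {}"
    using L \<open>supp t \<in> L\<close> unfolding abstract_complex_def by blast
  show ?thesis
    unfolding threshold_alt[OF t'] empty by simp
qed

text \<open>Let \<open>\<sigma>\<close> be the set of vertices other than \<open>a\<close> whose
  coordinates exceed the threshold. If it were nonempty and outside \<open>L\<close>, its minimal
  coordinate would be one of the values bounded by the threshold. The cone hypothesis then lets
  \<open>a\<close> be added.\<close>

lemma cone_flow_threshold:
  assumes L: "abstract_complex L" and apex: "{a} \<in> L"
    and cone: "\<And>\<sigma>. \<sigma> \<in> L \<Longrightarrow> \<sigma> \<subseteq> S \<Longrightarrow> insert a \<sigma> \<in> L"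
    and t: "t \<in> closed_simplex S"
  shows "\<exists>T\<in>L. T \<subseteq> insert a S \<and> cone_flow a (threshold L a t) t \<in> closed_simplex T"
proof -
  define s where "s = threshold L a t"
  define \<sigma> where "\<sigma> = {v. v \<noteq> a \<and> s < t v}"
  have "0 \<le> s"
    using threshold_nonneg[OF t] by (simp add: s_def)
  then have "\<sigma> \<subseteq> S"
    using closed_simplexD(2)[OF t] by (force simp: \<sigma>_def)
  then have fin: "finite \<sigma>"
    using closed_simplexD(4)[OF t] finite_subset by blast
  have "\<sigma> \<in> L" if "\<sigma> \<noteq> {}"
  proof (rule ccontr)
    assume "\<sigma> \<notin> L"
    then have "Min (t ` \<sigma>) \<le> s"
      unfolding s_def using that fin \<open>\<sigma> \<subseteq> S\<close>
      by (intro Min_le_threshold[OF t]) (auto simp: \<sigma>_def)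
    moreover have "s < Min (t ` \<sigma>)"
      using that fin by (auto simp: \<sigma>_def)
    ultimately show False by simp
  qed
  then have "insert a \<sigma> \<in> L"
    using apex cone[of \<sigma>] \<open>\<sigma> \<subseteq> S\<close> by (cases "\<sigma> = {}") auto
  moreover have "supp (cone_flow a s t) \<subseteq> insert a \<sigma>"
    by (auto simp: supp_def cone_flow_def \<sigma>_def)
  then have "cone_flow a s t \<in> closed_simplex (insert a \<sigma>)"
    using closed_simplex_mono[OF closed_simplex_supp[OF cone_flow_in_simplex[OF t \<open>0 \<le> s\<close>]]] fin by blast
  ultimately show ?thesis
    using \<open>\<sigma> \<subseteq> S\<close> unfolding s_def by blast
qed

lemma continuous_on_cone_flow:
  assumes g: "continuous_on A g" and f: "continuous_on A f" "f ` A \<subseteq> closed_simplex S"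
    and nonneg: "\<And>p. p \<in> A \<Longrightarrow> 0 \<le> g p"
  shows "continuous_on A (\<lambda>p. cone_flow a (g p) (f p))"
proof -
  have [continuous_intros]: "continuous_on A (\<lambda>p. f p v)" for v
    using f(1) by (rule continuous_on_product_then_coordinatewise)
  have "continuous_on A (\<lambda>p v. if v = a then 1 - (\<Sum>w \<in> S - {a}. max (f p w - g p) 0) else max (f p v - g p) 0)"
  proof (rule continuous_on_coordinatewise_then_product)
    fix v
    show "continuous_on A (\<lambda>p. if v = a then 1 - (\<Sum>w \<in> S - {a}. max (f p w - g p) 0) else max (f p v - g p) 0)"
      by (cases "v = a") (auto intro!: continuous_intros g)
  qed
  moreover have "(\<lambda>v. if v = a then 1 - (\<Sum>w \<in> S - {a}. max (f p w - g p) 0) else max (f p v - g p) 0)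
      = cone_flow a (g p) (f p)" if "p \<in> A" for p
    using that f(2) nonneg by (intro cone_flow_alt[symmetric]) auto
  ultimately show ?thesis
    by (rule continuous_on_eq)
qed

section \<open>Extending contractions over attached simplices\<close>

lemma contractionD:
  assumes "contraction K c h"
  shows "continuous_map (prod_topology (top_of_set {0..1}) (geometric_realization K)) (geometric_realization K) h"
    and "\<And>S t. S \<in> K \<Longrightarrow> t \<in> closed_simplex S \<Longrightarrow> h (0, t) = t"
    and "\<And>S t. S \<in> K \<Longrightarrow> t \<in> closed_simplex S \<Longrightarrow> h (1, t) = c"
  using assms unfolding contraction_def by blast+

lemma continuous_map_simplex_homotopy:
  assumes h: "contraction L c h" and "S \<in> L" "L \<subseteq> K"
  shows "continuous_map (top_of_set ({0..1::real} \<times> closed_simplex S)) (geometric_realization K) h"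
proof -
  have "continuous_map (top_of_set ({0..1::real} \<times> closed_simplex S)) (geometric_realization L) snd"
    by (rule continuous_map_into_realization[of "{S}"]) (use \<open>S \<in> L\<close> in \<open>auto intro: continuous_on_snd continuous_on_id\<close>)
  moreover have "continuous_map (top_of_set ({0..1::real} \<times> closed_simplex S)) (top_of_set {0..1}) fst"
    by (auto simp: continuous_map_in_subtopology intro: continuous_on_fst continuous_on_id)
  ultimately have "continuous_map (top_of_set ({0..1::real} \<times> closed_simplex S))
      (prod_topology (top_of_set {0..1}) (geometric_realization L)) (\<lambda>p. (fst p, snd p))"
    by (intro continuous_map_pairedI)
  then have "continuous_map (top_of_set ({0..1::real} \<times> closed_simplex S)) (geometric_realization L) (h \<circ> (\<lambda>p. p))"
    using contractionD(1)[OF h] continuous_map_compose by force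
  then have "continuous_map (top_of_set ({0..1::real} \<times> closed_simplex S)) (geometric_realization K)
      ((\<lambda>t. t) \<circ> (h \<circ> (\<lambda>p. p)))"
    using continuous_map_realization_mono[OF \<open>L \<subseteq> K\<close>] continuous_map_compose by blast
  then show ?thesis
    by (simp add: comp_def)
qed

text \<open>The map \<open>g\<close> may depend on \<open>S\<close>. A homotopy defined by cases on
  supports is thereby tested on one simplex at a time, where a single continuous formula describes
  it.\<close>

lemma contractionI:
  assumes "\<And>S. S \<in> K \<Longrightarrow>
      \<exists>g. continuous_map (top_of_set ({0..1::real} \<times> closed_simplex S)) (geometric_realization K) g \<and>
        (\<forall>\<tau>\<in>{0..1}. \<forall>t\<in>closed_simplex S. h (\<tau>, t) = g (\<tau>, t)) \<and>
        (\<forall>t\<in>closed_simplex S. g (0, t) = t \<and> g (1, t) = c)"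
  shows "contraction K c h"
  unfolding contraction_def
proof (intro conjI ballI)
  show "continuous_map (prod_topology (top_of_set {0..1}) (geometric_realization K)) (geometric_realization K) h"
  proof (rule continuous_map_homotopy_realization)
    fix S assume "S \<in> K"
    then obtain g where g: "continuous_map (top_of_set ({0..1::real} \<times> closed_simplex S)) (geometric_realization K) g"
      and eq: "\<forall>\<tau>\<in>{0..1}. \<forall>t\<in>closed_simplex S. h (\<tau>, t) = g (\<tau>, t)"
      using assms by blast
    show "continuous_map (top_of_set ({0..1::real} \<times> closed_simplex S)) (geometric_realization K) h"
      by (rule continuous_map_eq[OF g]) (use eq in auto)
  qed
next
  fix t assume "t \<in> \<Union>(closed_simplex ` K)"
  then obtain S where S: "S \<in> K" "t \<in> closed_simplex S" by blast
  from assms[OF S(1)] S(2) show "h (0, t) = t" "h (1, t) = c"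
    by (metis atLeastAtMost_iff order_refl zero_le_one)+
qed

text \<open>The flow runs at double speed up to time \<open>s\<close>, where it has reached
  \<open>L\<close>; then \<open>h\<close>, rescaled to the remaining interval, takes over. As
  thresholds are at most 1, halving keeps \<open>1 - s\<close> away from 0. The \<open>max 0\<close>
  clamps the time, so that the second branch is continuous on the whole domain and not only where it
  is used.\<close>

definition attached_homotopy ::
    "'v set set \<Rightarrow> (real \<times> ('v \<Rightarrow> real) \<Rightarrow> 'v \<Rightarrow> real) \<Rightarrow> 'v \<Rightarrow> real \<times> ('v \<Rightarrow> real) \<Rightarrow> 'v \<Rightarrow> real" where
  "attached_homotopy L h a p =
     (let s = threshold L a (snd p) / 2 in
      if fst p \<le> s then cone_flow a (2 * fst p) (snd p)
      else h (max 0 ((fst p - s) / (1 - s)), cone_flow a (2 * s) (snd p)))"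

lemma attached_homotopy:
  assumes L: "abstract_complex L" and "L \<subseteq> L'"
    and apex: "{a} \<in> L"
    and cone: "\<And>\<sigma>. \<sigma> \<in> L \<Longrightarrow> \<sigma> \<subseteq> S \<Longrightarrow> insert a \<sigma> \<in> L"
    and S: "finite S" "insert a S \<in> L'"
    and h: "contraction L c h"
  shows "continuous_map (top_of_set ({0..1::real} \<times> closed_simplex S)) (geometric_realization L')
      (attached_homotopy L h a)" (is ?cont)
    and "t \<in> closed_simplex S \<Longrightarrow> attached_homotopy L h a (0, t) = t"
    and "t \<in> closed_simplex S \<Longrightarrow> attached_homotopy L h a (1, t) = c"
    and "t \<in> closed_simplex S \<Longrightarrow> supp t \<in> L \<Longrightarrow> 0 \<le> \<tau> \<Longrightarrow> attached_homotopy L h a (\<tau>, t) = h (\<tau>, t)"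
proof -
  let ?D = "{0..1::real} \<times> closed_simplex S"
  define s where "s p = threshold L a (snd p) / 2" for p :: "real \<times> ('a \<Rightarrow> real)"
  have s_bounds: "0 \<le> s p" "s p \<le> 1/2" if "p \<in> ?D" for p
    using that threshold_nonneg[of "snd p" S L a] threshold_le_1[of "snd p" S L a] by (auto simp: s_def)
  have "continuous_on ?D (threshold L a \<circ> snd)"
    by (intro continuous_on_compose continuous_on_subset[OF continuous_on_threshold] continuous_on_snd continuous_on_id) auto
  then have s_cont: "continuous_on ?D s"
    unfolding s_def comp_def by (intro continuous_on_divide continuous_on_const) auto
  have fst_cont: "continuous_on ?D fst" and snd_cont: "continuous_on ?D snd"
    by (auto intro: continuous_on_fst continuous_on_snd continuous_on_id)
  have flow: "continuous_map (top_of_set ?D) (geometric_realization L') (\<lambda>p. cone_flow a (2 * fst p) (snd p))"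
  proof (rule continuous_map_into_realization[of "{insert a S}"])
    have "continuous_on ?D (\<lambda>p. cone_flow a (2 * fst p) (snd p))"
      by (rule continuous_on_cone_flow[of _ _ _ S]) (auto intro!: continuous_on_mult continuous_on_const fst_cont snd_cont)
    then show "continuous_map (top_of_set ?D) euclidean (\<lambda>p. cone_flow a (2 * fst p) (snd p))"
      by simp
  qed (use S in \<open>auto intro!: cone_flow_in_simplex\<close>)
  have retract_in: "\<exists>T\<in>{T \<in> L. T \<subseteq> insert a S}. cone_flow a (2 * s p) (snd p) \<in> closed_simplex T" if "p \<in> ?D" for p
  proof -
    have "snd p \<in> closed_simplex S" using that by auto
    then show ?thesis
      using cone_flow_threshold[OF L apex, of S "snd p"] cone unfolding s_def by auto
  qed
  have retract: "continuous_map (top_of_set ?D) (geometric_realization L) (\<lambda>p. cone_flow a (2 * s p) (snd p))"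
  proof (rule continuous_map_into_realization[of "{T \<in> L. T \<subseteq> insert a S}"])
    show "finite {T \<in> L. T \<subseteq> insert a S}"
      by (rule finite_subset[of _ "Pow (insert a S)"]) (use S in auto)
    have "continuous_on ?D (\<lambda>p. cone_flow a (2 * s p) (snd p))"
      by (rule continuous_on_cone_flow[of _ _ _ S])
        (auto intro!: continuous_on_mult continuous_on_const s_cont snd_cont s_bounds)
    then show "continuous_map (top_of_set ?D) euclidean (\<lambda>p. cone_flow a (2 * s p) (snd p))"
      by simp
  qed (use retract_in in auto)
  define r where "r p = max 0 ((fst p - s p) / (1 - s p))" for p
  have "r p \<le> 1" if "p \<in> ?D" for p
    using that s_bounds[OF that] by (auto simp: r_def divide_simps)
  moreover have "continuous_on ?D r"
  proof -
    have "1 - s p \<noteq> 0" if "p \<in> ?D" for p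
      using s_bounds[OF that] by simp
    then show ?thesis
      unfolding r_def
      by (intro continuous_on_max continuous_on_divide continuous_on_diff continuous_on_const s_cont fst_cont) blast
  qed
  ultimately have "continuous_map (top_of_set ?D) (top_of_set {0..1}) r"
    by (auto simp: continuous_map_in_subtopology r_def)
  then have "continuous_map (top_of_set ?D) (prod_topology (top_of_set {0..1}) (geometric_realization L))
      (\<lambda>p. (r p, cone_flow a (2 * s p) (snd p)))"
    using retract by (intro continuous_map_pairedI)
  then have "continuous_map (top_of_set ?D) (geometric_realization L) (h \<circ> (\<lambda>p. (r p, cone_flow a (2 * s p) (snd p))))"
    using contractionD(1)[OF h] continuous_map_compose by blast
  then have "continuous_map (top_of_set ?D) (geometric_realization L')
      ((\<lambda>t. t) \<circ> (h \<circ> (\<lambda>p. (r p, cone_flow a (2 * s p) (snd p)))))"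
    using continuous_map_realization_mono[OF \<open>L \<subseteq> L'\<close>] continuous_map_compose by blast
  then have after: "continuous_map (top_of_set ?D) (geometric_realization L') (\<lambda>p. h (r p, cone_flow a (2 * s p) (snd p)))"
    by (simp add: comp_def)
  have eq: "attached_homotopy L h a = (\<lambda>p. if fst p \<le> s p then cone_flow a (2 * fst p) (snd p)
      else h (r p, cone_flow a (2 * s p) (snd p)))"
    by (simp add: fun_eq_iff attached_homotopy_def s_def r_def Let_def)
  have h_retract: "h (0, cone_flow a (2 * s p) (snd p)) = cone_flow a (2 * s p) (snd p)"
    "h (1, cone_flow a (2 * s p) (snd p)) = c" if "p \<in> ?D" for p
    using retract_in[OF that] contractionD(2,3)[OF h] by auto
  show ?cont
    unfolding eq
  proof (rule continuous_map_cases_le)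
    fix p assume p: "p \<in> topspace (top_of_set ?D)" "fst p = s p"
    then have "r p = 0" by (simp add: r_def)
    then show "cone_flow a (2 * fst p) (snd p) = h (r p, cone_flow a (2 * s p) (snd p))"
      using h_retract[of p] p by simp
  qed (use fst_cont s_cont in \<open>auto intro: continuous_map_from_subtopology flow after\<close>)
  assume t: "t \<in> closed_simplex S"
  show "attached_homotopy L h a (0, t) = t"
    using t s_bounds[of "(0, t)"] by (simp add: eq cone_flow_0)
  have "(1, t) \<in> ?D"
    using t by simp
  moreover from s_bounds[OF this] have "\<not> 1 \<le> s (1, t)" "r (1, t) = 1"
    by (auto simp: r_def)
  ultimately show "attached_homotopy L h a (1, t) = c"
    using h_retract(2)[of "(1, t)"] by (simp add: eq)
  assume "supp t \<in> L" and "0 \<le> \<tau>"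
  have "t \<in> closed_simplex (supp t)"
    using closed_simplex_supp[OF t] .
  then have "h (0, t) = t"
    using contractionD(2)[OF h \<open>supp t \<in> L\<close>] by blast
  moreover have "s (\<tau>, t) = 0"
    using threshold_eq_0[OF L t \<open>supp t \<in> L\<close>] by (simp add: s_def)
  \<comment> \<open>With \<open>s = 0\<close> the flow branch is taken only at
    \<open>\<tau> = 0\<close>, where it is the identity, just like \<open>h\<close>; afterwards the
    rescaling of time is trivial.\<close>
  ultimately show "attached_homotopy L h a (\<tau>, t) = h (\<tau>, t)"
    using \<open>0 \<le> \<tau>\<close> cone_flow_0[OF t] by (cases "\<tau> = 0") (auto simp: eq r_def)
qed

text \<open>\<open>B x\<close> is the vertex set of a possibly infinite simplex, attached through
  its finite faces. A face outside \<open>L\<close> lies in \<open>B x\<close> for only one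
  \<open>x\<close>, so its support tells which apex to use; on \<open>L\<close> the new map is
  \<open>h\<close> by definition, and \<open>attached_homotopy\<close> agrees with it there.\<close>

lemma cone_attachment_extends_contraction:
  assumes L: "abstract_complex L"
    and L': "L' = L \<union> {\<sigma>. finite \<sigma> \<and> \<sigma> \<noteq> {} \<and> (\<exists>x\<in>I. \<sigma> \<subseteq> B x)}"
    and apex: "\<And>x. x \<in> I \<Longrightarrow> a x \<in> B x \<and> {a x} \<in> L"
    and cone: "\<And>x \<sigma>. x \<in> I \<Longrightarrow> \<sigma> \<in> L \<Longrightarrow> \<sigma> \<subseteq> B x \<Longrightarrow> insert (a x) \<sigma> \<in> L"
    and disjoint: "\<And>x y \<sigma>. x \<in> I \<Longrightarrow> y \<in> I \<Longrightarrow> x \<noteq> y \<Longrightarrow> finite \<sigma> \<Longrightarrow> \<sigma> \<noteq> {} \<Longrightarrow>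
        \<sigma> \<subseteq> B x \<Longrightarrow> \<sigma> \<subseteq> B y \<Longrightarrow> \<sigma> \<in> L"
    and h: "contraction L c h"
  shows "\<exists>h'. contraction L' c h' \<and> (\<forall>t\<in>\<Union>(closed_simplex ` L). \<forall>\<tau>. h' (\<tau>, t) = h (\<tau>, t))"
proof -
  define h' where "h' p = (if supp (snd p) \<in> L then h p
      else attached_homotopy L h (a (THE x. x \<in> I \<and> supp (snd p) \<subseteq> B x)) p)" for p
  have "contraction L' c h'"
  proof (rule contractionI)
    fix S assume S: "S \<in> L'"
    show "\<exists>g. continuous_map (top_of_set ({0..1::real} \<times> closed_simplex S)) (geometric_realization L') g \<and>
        (\<forall>\<tau>\<in>{0..1}. \<forall>t\<in>closed_simplex S. h' (\<tau>, t) = g (\<tau>, t)) \<and>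
        (\<forall>t\<in>closed_simplex S. g (0, t) = t \<and> g (1, t) = c)"
    proof (cases "S \<in> L")
      case True
      have "supp t \<in> L" if "t \<in> closed_simplex S" for t
        using in_realization_iff[OF L that] that True by blast
      then show ?thesis
        using continuous_map_simplex_homotopy[OF h True, of L'] contractionD(2,3)[OF h True] L'
        by (intro exI[of _ h]) (auto simp: h'_def)
    next
      case False
      then obtain x where x: "x \<in> I" "S \<subseteq> B x" and fin: "finite S" "S \<noteq> {}"
        using S L' by blast
      have "insert (a x) S \<in> L'"
        using x fin apex[OF x(1)] unfolding L' by blast
      moreover have "insert (a x) \<sigma> \<in> L" if "\<sigma> \<in> L" "\<sigma> \<subseteq> S" for \<sigma>
        using cone[OF x(1)] that x(2) by blast
      ultimately have *:
        "continuous_map (top_of_set ({0..1::real} \<times> closed_simplex S)) (geometric_realization L') (attached_homotopy L h (a x))"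
        "\<And>t. t \<in> closed_simplex S \<Longrightarrow> attached_homotopy L h (a x) (0, t) = t"
        "\<And>t. t \<in> closed_simplex S \<Longrightarrow> attached_homotopy L h (a x) (1, t) = c"
        "\<And>t \<tau>. t \<in> closed_simplex S \<Longrightarrow> supp t \<in> L \<Longrightarrow> 0 \<le> \<tau> \<Longrightarrow>
           attached_homotopy L h (a x) (\<tau>, t) = h (\<tau>, t)"
        using attached_homotopy[OF L _ _ _ fin(1) _ h, of L' "a x"] apex[OF x(1)] L' by auto
      moreover have "h' (\<tau>, t) = attached_homotopy L h (a x) (\<tau>, t)"
        if "\<tau> \<in> {0..1}" "t \<in> closed_simplex S" for \<tau> t
      proof (cases "supp t \<in> L")
        case True
        then show ?thesis
          using *(4) that by (simp add: h'_def)
      next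
        case False
        have supp: "supp t \<subseteq> S" "supp t \<noteq> {}" "finite (supp t)"
          using closed_simplexD[OF that(2)] finite_subset by blast+
        have "(THE x. x \<in> I \<and> supp t \<subseteq> B x) = x"
        proof (rule the_equality)
          fix y assume y: "y \<in> I \<and> supp t \<subseteq> B y"
          show "y = x"
          proof (rule ccontr)
            assume "y \<noteq> x"
            with y x supp have "supp t \<in> L"
              by (intro disjoint[of y x]) auto
            with False show False by blast
          qed
        qed (use x supp in auto)
        then show ?thesis
          using False by (simp add: h'_def)
      qed
      ultimately show ?thesis by blast
    qed
  qed
  moreover have "h' (\<tau>, t) = h (\<tau>, t)" if t: "t \<in> \<Union>(closed_simplex ` L)" for \<tau> t
  proof -
    obtain S where "t \<in> closed_simplex S" using t by blast
    then have "supp t \<in> L"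
      using in_realization_iff[OF L] t by blast
    then show ?thesis by (simp add: h'_def)
  qed
  ultimately show ?thesis by blast
qed

text \<open>Exact agreement on earlier stages makes the union of the maps well defined. Continuity
  is tested on a single simplex, which already lies in some stage.\<close>

lemma contraction_Union:
  fixes L :: "nat \<Rightarrow> 'v set set"
  assumes mono: "\<And>n. L n \<subseteq> L (Suc n)"
    and h: "\<And>n. contraction (L n) c (h n)"
    and ext: "\<And>n t \<tau>. t \<in> \<Union>(closed_simplex ` L n) \<Longrightarrow> h (Suc n) (\<tau>, t) = h n (\<tau>, t)"
  shows "\<exists>h'. contraction (\<Union>n. L n) c h'"
proof -
  have le: "L m \<subseteq> L n" if "m \<le> n" for m n
    using lift_Suc_mono_le[of L] mono that by blast
  have h_eq: "h n (\<tau>, t) = h m (\<tau>, t)" if "m \<le> n" "t \<in> \<Union>(closed_simplex ` L m)" for m n t \<tau>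
    using that
  proof (induction n rule: dec_induct)
    case (step n)
    then have "t \<in> \<Union>(closed_simplex ` L n)"
      using le by blast
    with step ext show ?case by simp
  qed simp
  define h' where "h' p = h (LEAST n. snd p \<in> \<Union>(closed_simplex ` L n)) p" for p
  have h': "h' (\<tau>, t) = h n (\<tau>, t)" if t: "t \<in> \<Union>(closed_simplex ` L n)" for n \<tau> t
  proof -
    let ?m = "LEAST n. t \<in> \<Union>(closed_simplex ` L n)"
    have "?m \<le> n" "t \<in> \<Union>(closed_simplex ` L ?m)"
      using t by (rule Least_le, rule LeastI)
    then show ?thesis
      using h_eq by (simp add: h'_def)
  qed
  have "contraction (\<Union>n. L n) c h'"
  proof (rule contractionI)
    fix S assume "S \<in> (\<Union>n. L n)"
    then obtain n where n: "S \<in> L n" by blast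
    have "continuous_map (top_of_set ({0..1::real} \<times> closed_simplex S)) (geometric_realization (\<Union>n. L n)) (h n)"
      by (rule continuous_map_simplex_homotopy[OF h n]) blast
    moreover have "h' (\<tau>, t) = h n (\<tau>, t)" if "t \<in> closed_simplex S" for \<tau> t
      using h' n that by blast
    moreover have "h n (0, t) = t \<and> h n (1, t) = c" if "t \<in> closed_simplex S" for t
      using contractionD(2,3)[OF h n that] by simp
    ultimately show "\<exists>g. continuous_map (top_of_set ({0..1::real} \<times> closed_simplex S)) (geometric_realization (\<Union>n. L n)) g \<and>
        (\<forall>\<tau>\<in>{0..1}. \<forall>t\<in>closed_simplex S. h' (\<tau>, t) = g (\<tau>, t)) \<and>
        (\<forall>t\<in>closed_simplex S. g (0, t) = t \<and> g (1, t) = c)"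
      by (intro exI[of _ "h n"]) simp
  qed
  then show ?thesis by blast
qed

lemma contraction_vertex: "contraction {{M}} (vertex_point M) snd"
proof (rule contractionI)
  fix S assume "S \<in> {{M}}"
  then have S: "S = {M}" by simp
  have "t = vertex_point M" if "t \<in> closed_simplex S" for t
    using closed_simplexD(2,3)[OF that] S by (auto simp: vertex_point_def fun_eq_iff)
  moreover have "continuous_map (top_of_set ({0..1::real} \<times> closed_simplex S)) (geometric_realization {{M}}) snd"
    by (rule continuous_map_into_realization[of "{S}"]) (use S in \<open>auto intro: continuous_on_snd continuous_on_id\<close>)
  ultimately show "\<exists>g. continuous_map (top_of_set ({0..1::real} \<times> closed_simplex S)) (geometric_realization {{M}}) g \<and>
        (\<forall>\<tau>\<in>{0..1}. \<forall>t\<in>closed_simplex S. snd (\<tau>, t) = g (\<tau>, t)) \<and>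
        (\<forall>t\<in>closed_simplex S. g (0, t) = t \<and> g (1, t) = vertex_point M)"
    by (intro exI[of _ snd]) auto
qed

theorem contractible_space_cone_filtration:
  fixes L :: "nat \<Rightarrow> 'v set set" and I :: "nat \<Rightarrow> 'x set"
  assumes L0: "L 0 = {{M}}"
    and L_Suc: "\<And>n. L (Suc n) = L n \<union> {\<sigma>. finite \<sigma> \<and> \<sigma> \<noteq> {} \<and> (\<exists>x\<in>I n. \<sigma> \<subseteq> B x)}"
    and apex: "\<And>n x. x \<in> I n \<Longrightarrow> a x \<in> B x \<and> {a x} \<in> L n"
    and cone: "\<And>n x \<sigma>. x \<in> I n \<Longrightarrow> \<sigma> \<in> L n \<Longrightarrow> \<sigma> \<subseteq> B x \<Longrightarrow> insert (a x) \<sigma> \<in> L n"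
    and disjoint: "\<And>n x y \<sigma>. x \<in> I n \<Longrightarrow> y \<in> I n \<Longrightarrow> x \<noteq> y \<Longrightarrow> finite \<sigma> \<Longrightarrow> \<sigma> \<noteq> {} \<Longrightarrow>
        \<sigma> \<subseteq> B x \<Longrightarrow> \<sigma> \<subseteq> B y \<Longrightarrow> \<sigma> \<in> L n"
  shows "contractible_space (geometric_realization (\<Union>n. L n))"
proof -
  have complex: "abstract_complex (L n)" for n
  proof (induction n)
    case 0
    have "\<rho> \<in> {{M}}" if "\<rho> \<subseteq> {M}" "\<rho> \<noteq> {}" for \<rho>
      using that by (simp add: subset_singleton_iff)
    then show ?case
      by (auto simp: L0 abstract_complex_def)
  next
    case (Suc n)
    then show ?case
      unfolding L_Suc abstract_complex_def
      by (auto intro: finite_subset)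
  qed
  obtain h where h: "\<And>n. contraction (L n) (vertex_point M) (h n)"
    "\<And>n. \<forall>t\<in>\<Union>(closed_simplex ` L n). \<forall>\<tau>. h (Suc n) (\<tau>, t) = h n (\<tau>, t)"
  proof -
    have "\<exists>h. \<forall>n. contraction (L n) (vertex_point M) (h n) \<and>
        (\<forall>t\<in>\<Union>(closed_simplex ` L n). \<forall>\<tau>. h (Suc n) (\<tau>, t) = h n (\<tau>, t))"
    \<comment> \<open>Dependent choice, because each contraction has to extend the particular one
      chosen before it.\<close>
    proof (rule dependent_nat_choice)
      show "\<exists>h. contraction (L 0) (vertex_point M) h"
        using contraction_vertex L0 by metis
      fix g n assume g: "contraction (L n) (vertex_point M) g"
      show "\<exists>g'. contraction (L (Suc n)) (vertex_point M) g' \<and>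
          (\<forall>t\<in>\<Union>(closed_simplex ` L n). \<forall>\<tau>. g' (\<tau>, t) = g (\<tau>, t))"
        by (rule cone_attachment_extends_contraction[OF complex L_Suc[of n]])
          (use g apex[of _ n] cone[of _ n] disjoint[of _ n] in blast)+
    qed
    with that show thesis by blast
  qed
  have "\<exists>h'. contraction (\<Union>n. L n) (vertex_point M) h'"
    by (rule contraction_Union[where h = h]) (use h L_Suc in auto)
  then show ?thesis
    using contractible_realizationI by blast
qed

section \<open>Metric properties of quasi-median graphs\<close>

locale quasi_median =
  fixes V :: "'a set" and E :: "'a set set"
  assumes quasi_median: "quasi_median_graph V E"
begin

definition adj :: "'a \<Rightarrow> 'a \<Rightarrow> bool" where "adj x y \<longleftrightarrow> {x, y} \<in> E"
abbreviation d :: "'a \<Rightarrow> 'a \<Rightarrow> nat" where "d \<equiv> graph_dist E"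

lemma simple: "simple_graph V E"
  and connected: "connected_graph V E"
  and no_K23: "\<not> has_induced_K23 V E"
  and no_K4_minus_edge: "\<not> has_induced_K4_minus_edge V E"
  using quasi_median by (auto simp: quasi_median_graph_def connected_graph_def)

lemma adj_commute: "adj x y \<longleftrightarrow> adj y x"
  by (simp add: adj_def insert_commute)

lemma adjD:
  assumes "adj x y"
  shows "x \<in> V" "y \<in> V" "x \<noteq> y"
proof -
  obtain u v where "u \<in> V" "v \<in> V" "u \<noteq> v" "{x, y} = {u, v}"
    using simple assms unfolding simple_graph_def adj_def by blast
  then show "x \<in> V" "y \<in> V" "x \<noteq> y"
    by (auto simp: doubleton_eq_iff)
qed

lemma walk: "x \<in> V \<Longrightarrow> y \<in> V \<Longrightarrow> (x, y) \<in> adj_rel E ^^ d x y"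
proof -
  assume "x \<in> V" "y \<in> V"
  then have "\<exists>n. (x, y) \<in> adj_rel E ^^ n"
    using connected unfolding connected_graph_def by (simp add: rtrancl_power)
  then show ?thesis
    unfolding graph_dist_def by (rule LeastI_ex)
qed

lemma dist_le: "(x, y) \<in> adj_rel E ^^ n \<Longrightarrow> d x y \<le> n"
  unfolding graph_dist_def by (rule Least_le)

lemma dist_commute: "d x y = d y x"
proof -
  have "(y, x) \<in> adj_rel E ^^ n" if "(x, y) \<in> adj_rel E ^^ n" for x y n
    using that
  proof (induction n arbitrary: y)
    case (Suc n)
    then obtain z where "(x, z) \<in> adj_rel E ^^ n" "(z, y) \<in> adj_rel E"
      by auto
    then show ?case
      using Suc.IH[of z] relpow_Suc_I2[of y z "adj_rel E" x n]
      by (simp add: adj_rel_def insert_commute)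
  qed simp
  then have "(x, y) \<in> adj_rel E ^^ n \<longleftrightarrow> (y, x) \<in> adj_rel E ^^ n" for n
    by blast
  then show ?thesis
    by (simp add: graph_dist_def)
qed

lemma dist_self [simp]: "d x x = 0"
  using dist_le[of x x 0] by simp

lemma dist_eq_0: "x \<in> V \<Longrightarrow> y \<in> V \<Longrightarrow> d x y = 0 \<longleftrightarrow> x = y"
  using walk[of x y] by auto

lemma dist_triangle: "x \<in> V \<Longrightarrow> y \<in> V \<Longrightarrow> z \<in> V \<Longrightarrow> d x z \<le> d x y + d y z"
  using walk[of x y] walk[of y z] by (intro dist_le) (auto simp: relpow_add)

lemma adj_iff_dist: "x \<in> V \<Longrightarrow> y \<in> V \<Longrightarrow> adj x y \<longleftrightarrow> d x y = 1"
proof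
  assume "x \<in> V" "y \<in> V" "adj x y"
  then have "d x y \<le> 1"
    by (intro dist_le) (auto simp: adj_def adj_rel_def)
  moreover have "d x y \<noteq> 0"
    using dist_eq_0 adjD[OF \<open>adj x y\<close>] by blast
  ultimately show "d x y = 1" by simp
next
  assume "x \<in> V" "y \<in> V" "d x y = 1"
  then show "adj x y"
    using walk[of x y] by (simp add: adj_def adj_rel_def)
qed

lemma dist_adj:
  assumes "p \<in> V" "adj x y"
  shows "d p x \<le> d p y + 1" "d p y \<le> d p x + 1"
  using assms adjD[OF assms(2)] adj_iff_dist[of x y] dist_triangle[of p y x] dist_triangle[of p x y]
    dist_commute[of x y] by auto

lemma ex_closer_neighbour:
  assumes "p \<in> V" "x \<in> V" "p \<noteq> x"
  obtains q where "q \<in> V" "adj x q" "d p q + 1 = d p x"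
proof -
  obtain n where n: "d p x = Suc n"
    using dist_eq_0 assms by (metis not0_implies_Suc)
  then obtain q where q: "(p, q) \<in> adj_rel E ^^ n" "(q, x) \<in> adj_rel E"
    using walk[OF assms(1,2)] by auto
  then have "adj x q" by (auto simp: adj_def adj_rel_def insert_commute)
  moreover have "d p q \<le> n" using q dist_le by blast
  moreover have "d p x \<le> d p q + 1" using dist_adj(1)[OF \<open>p \<in> V\<close> \<open>adj x q\<close>] .
  ultimately show thesis
    using that adjD n by (metis Suc_eq_plus1 le_antisym Suc_le_mono)
qed

lemma common_neighbour_dist2:
  assumes "adj x y" "adj y z" "x \<noteq> z" "\<not> adj x z"
  shows "d x z = 2"
proof -
  have V: "x \<in> V" "y \<in> V" "z \<in> V" using assms adjD by blast+
  have "d x z \<le> d x y + d y z" by (rule dist_triangle) (use V in auto)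
  then have "d x z \<le> 2" using assms V adj_iff_dist by simp
  moreover have "d x z \<noteq> 0" "d x z \<noteq> 1" using assms V adj_iff_dist dist_eq_0 by auto
  ultimately show ?thesis by simp
qed

section \<open>Forbidden subgraphs, and squares seen from a base vertex\<close>

lemma K23:
  assumes "adj a x" "adj a y" "adj a z" "adj b x" "adj b y" "adj b z"
    "a \<noteq> b" "x \<noteq> y" "y \<noteq> z" "x \<noteq> z"
    "\<not> adj a b" "\<not> adj x y" "\<not> adj y z" "\<not> adj x z"
  shows False
proof -
  have "a \<in> V" "b \<in> V" "x \<in> V" "y \<in> V" "z \<in> V" "distinct [a, b, x, y, z]"
    using assms adjD by auto
  then have "has_induced_K23 V E"
    unfolding has_induced_K23_def adj_def[symmetric] using assms by blast
  with no_K23 show False by blast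
qed

lemma K4_minus_edge:
  assumes "adj a x" "adj a y" "adj b x" "adj b y" "adj x y" "a \<noteq> b"
  shows "adj a b"
proof (rule ccontr)
  assume "\<not> adj a b"
  have "a \<in> V" "b \<in> V" "x \<in> V" "y \<in> V" "distinct [a, b, x, y]"
    using assms adjD by auto
  then have "has_induced_K4_minus_edge V E"
    unfolding has_induced_K4_minus_edge_def adj_def[symmetric] using assms \<open>\<not> adj a b\<close> by blast
  with no_K4_minus_edge show False by blast
qed

lemma triangle:
  assumes "p \<in> V" "adj x y" "d p x = d p y"
  obtains w where "adj x w" "adj y w" "d p w + 1 = d p x"
proof -
  have V: "x \<in> V" "y \<in> V" "x \<noteq> y" using adjD assms by blast+
  have "d p x \<noteq> 0" using dist_eq_0 V assms by metis
  then have "d p x \<ge> 1" by simp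
  then obtain w where "adj x w" "adj y w" "d p w = d p x - 1"
    using quasi_median V assms unfolding quasi_median_graph_def triangle_condition_def adj_def[symmetric] by metis
  with that \<open>d p x \<ge> 1\<close> show thesis by simp
qed

text \<open>If \<open>x\<close> and \<open>y\<close> were adjacent, the triangle condition would
  give a common neighbour \<open>w\<close> one step closer to \<open>p\<close>. The absence of an
  induced K4 minus an edge would make \<open>v\<close> adjacent to \<open>w\<close>, although their
  distances from \<open>p\<close> differ by 2.\<close>

lemma closer_neighbours_nonadj:
  assumes "p \<in> V" "adj v x" "adj v y" "d p x + 1 = d p v" "d p y + 1 = d p v"
  shows "\<not> adj x y"
proof
  assume "adj x y"
  then obtain w where w: "adj x w" "adj y w" "d p w + 1 = d p x"
    using triangle[of p x y] assms by auto
  have "v \<noteq> w" using w assms by auto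
  then have "adj v w"
    using K4_minus_edge[of v x y w] assms w \<open>adj x y\<close> by (auto simp: adj_commute)
  then show False
    using dist_adj(1)[of p v w] assms w by simp
qed

lemma quadrangle:
  assumes "p \<in> V" "adj v x" "adj v y" "d p x + 1 = d p v" "d p y + 1 = d p v" "x \<noteq> y"
  obtains w where "adj x w" "adj y w" "d p w + 2 = d p v"
proof -
  have V: "x \<in> V" "y \<in> V" "v \<in> V" using adjD assms by blast+
  \<comment> \<open>Distance 0 would force both \<open>x\<close> and \<open>y\<close> to equal
    \<open>p\<close>; hence the natural number subtraction in the quadrangle condition is
    exact.\<close>
  have "d p x \<noteq> 0"
    using dist_eq_0[of p x] dist_eq_0[of p y] V assms by auto
  moreover obtain w where "adj x w" "adj y w" "d p w = d p x - 1"
  proof -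
    have "\<not> adj x y" using closer_neighbours_nonadj assms by blast
    moreover have "adj x v" "adj y v"
      using assms adj_commute by blast+
    moreover have "d p y = d p x" "d p v = d p x + 1"
      using assms by simp_all
    moreover have "quadrangle_condition V E"
      using quasi_median by (simp add: quasi_median_graph_def)
    ultimately have "\<exists>w\<in>V. adj x w \<and> adj y w \<and> d p w = d p x - 1"
      unfolding quadrangle_condition_def adj_def[symmetric]
      using V \<open>p \<in> V\<close> \<open>x \<noteq> y\<close> by blast
    with that show thesis by blast
  qed
  ultimately show thesis
    using that assms by simp
qed

text \<open>The quadrangle condition provides a vertex \<open>m\<close> two steps below
  \<open>a\<close>. A different \<open>c\<close> would form an induced K_{2,3} with
  \<open>a\<close>, \<open>m\<close> against \<open>x\<close>, \<open>y\<close>, or, if adjacent to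
  \<open>m\<close>, would force \<open>x\<close> and \<open>y\<close> to be adjacent.\<close>

lemma square_top:
  assumes "p \<in> V" "adj a x" "adj a y" "adj c x" "adj c y" "x \<noteq> y" "a \<noteq> c" "\<not> adj a c"
    and "d p x + 1 = d p a" "d p y + 1 = d p a"
  shows "d p c + 2 = d p a"
proof -
  obtain m where m: "adj x m" "adj y m" "d p m + 2 = d p a"
    using quadrangle[of p a x y] assms by blast
  have xy: "\<not> adj x y"
    using closer_neighbours_nonadj assms by blast
  have am: "\<not> adj a m" "a \<noteq> m"
    using dist_adj(1)[of p a m] m assms by auto
  have "c = m"
  proof (rule ccontr)
    assume "c \<noteq> m"
    show False
    proof (cases "adj c m")
      case True
      then have "adj x y"
        using K4_minus_edge[of x c m y] m assms by (auto simp: adj_commute)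
      with xy show False by blast
    next
      case False
      show False
        by (rule K23[of x a c m y]) (use assms m am xy False \<open>c \<noteq> m\<close> in \<open>auto simp: adj_commute\<close>)
    qed
  qed
  with m show ?thesis by simp
qed

text \<open>The triangle condition on \<open>a\<close>, \<open>d'\<close> gives \<open>w\<close>,
  and the quadrangle condition at \<open>a\<close> then gives \<open>m\<close> below both
  \<open>b\<close> and \<open>w\<close>. Seen from \<open>d'\<close>, both ends of the edge from
  \<open>b\<close> to \<open>m\<close> are at distance 2, so the triangle condition yields a third
  common neighbour \<open>x\<close> of \<open>b\<close> and \<open>d'\<close>; together with
  \<open>a\<close> and \<open>c\<close> it completes an induced K_{2,3}.\<close>

lemma no_square_single_bottom:
  assumes "p \<in> V" "adj b a" "adj b c" "adj d' a" "adj d' c" "a \<noteq> c" "b \<noteq> d'" "\<not> adj a c" "\<not> adj b d'"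
    and "d p a = d p b + 1" "d p c = d p b + 1" "d p d' = d p b + 1"
  shows False
proof -
  obtain w where w: "adj a w" "adj d' w" "d p w + 1 = d p a"
    using triangle[of p a d'] assms by (auto simp: adj_commute)
  have "w \<noteq> b" using w assms by (auto simp: adj_commute)
  then obtain m where m: "adj b m" "adj w m" "d p m + 2 = d p a"
    using quadrangle[of p a b w] assms w by (auto simp: adj_commute)
  have "\<not> adj d' m" "d' \<noteq> m"
    using dist_adj(1)[of p d' m] m assms by auto
  then have "d d' m = 2"
    using common_neighbour_dist2[of d' w m] w m by blast
  moreover have "d d' b = 2"
    using common_neighbour_dist2[of d' a b] assms by (auto simp: adj_commute)
  moreover have "d' \<in> V" using assms adjD by blast
  ultimately obtain x where x: "adj b x" "adj m x" "d d' x + 1 = 2"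
    using triangle[of d' b m] m by metis
  have "adj d' x"
    using adj_iff_dist[of d' x] x \<open>d' \<in> V\<close> adjD(2)[OF x(1)] by simp
  have "d p x + 1 = d p a"
    using dist_adj(1)[OF \<open>p \<in> V\<close> \<open>adj d' x\<close>] dist_adj(2)[OF \<open>p \<in> V\<close> \<open>adj m x\<close>] m assms by simp
  then have "\<not> adj a x" "\<not> adj c x"
    using closer_neighbours_nonadj[of p a b x] closer_neighbours_nonadj[of p c b x] x assms by (auto simp: adj_commute)
  moreover have "a \<noteq> x" "c \<noteq> x"
    using \<open>d p x + 1 = d p a\<close> assms by auto
  ultimately show False
    using K23[of b a c x d'] assms x \<open>adj d' x\<close> \<open>d p x + 1 = d p a\<close> by (auto simp: adj_commute)
qed

text \<open>With at least two vertices these are exactly the maximal cliques, since no K4 minus an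
  edge is induced; singletons also qualify. Closure under common neighbours is the form in which
  maximality is applied.\<close>

definition closed_clique :: "'a set \<Rightarrow> bool" where
  "closed_clique C \<longleftrightarrow> C \<subseteq> V \<and> C \<noteq> {} \<and> (\<forall>x\<in>C. \<forall>y\<in>C. x \<noteq> y \<longrightarrow> adj x y) \<and>
     (\<forall>x\<in>C. \<forall>y\<in>C. \<forall>w. x \<noteq> y \<longrightarrow> adj w x \<longrightarrow> adj w y \<longrightarrow> w \<in> C)"

lemma closed_cliqueD:
  assumes "closed_clique C"
  shows "C \<subseteq> V" "\<exists>x. x \<in> C"
    and "x \<in> C \<Longrightarrow> y \<in> C \<Longrightarrow> x \<noteq> y \<Longrightarrow> adj x y"
    and "x \<in> C \<Longrightarrow> y \<in> C \<Longrightarrow> x \<noteq> y \<Longrightarrow> adj w x \<Longrightarrow> adj w y \<Longrightarrow> w \<in> C"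
proof -
  note * = assms[unfolded closed_clique_def]
  show "C \<subseteq> V" "\<exists>x. x \<in> C"
    using *[THEN conjunct1] *[THEN conjunct2, THEN conjunct1] by blast+
  show "x \<in> C \<Longrightarrow> y \<in> C \<Longrightarrow> x \<noteq> y \<Longrightarrow> adj x y"
    by (rule *[THEN conjunct2, THEN conjunct2, THEN conjunct1, rule_format])
  show "x \<in> C \<Longrightarrow> y \<in> C \<Longrightarrow> x \<noteq> y \<Longrightarrow> adj w x \<Longrightarrow> adj w y \<Longrightarrow> w \<in> C"
    by (rule *[THEN conjunct2, THEN conjunct2, THEN conjunct2, rule_format])
qed

lemma edge_in_closed_clique:
  assumes "adj x y"
  obtains C where "closed_clique C" "x \<in> C" "y \<in> C"
proof
  let ?C = "{x, y} \<union> {z. adj z x \<and> adj z y}"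
  have clique: "adj u v" if "u \<in> ?C" "v \<in> ?C" "u \<noteq> v" for u v
    using that assms K4_minus_edge[of u x y v] by (auto simp: adj_commute)
  have closed: "w \<in> ?C" if "u \<in> ?C" "v \<in> ?C" "u \<noteq> v" "adj w u" "adj w v" for u v w
  proof -
    have "adj w e" if "e \<in> ?C" "e \<noteq> w" for e
    proof (cases "e = u \<or> e = v")
      case True
      then show ?thesis using \<open>adj w u\<close> \<open>adj w v\<close> by blast
    next
      case False
      then show ?thesis
        using K4_minus_edge[of w u v e] clique[of e u] clique[of e v] clique[of u v]
          \<open>u \<in> ?C\<close> \<open>v \<in> ?C\<close> \<open>u \<noteq> v\<close> \<open>adj w u\<close> \<open>adj w v\<close> that by blast
    qed
    from this[of x] this[of y] show ?thesis by blast
  qed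
  show "closed_clique ?C"
    unfolding closed_clique_def
  proof (intro conjI ballI allI impI)
    show "?C \<subseteq> V"
      using assms adjD by auto
    show "?C \<noteq> {}" by simp
  next
    fix u v assume "u \<in> ?C" "v \<in> ?C" "u \<noteq> v"
    then show "adj u v" by (rule clique)
  next
    fix u v w assume "u \<in> ?C" "v \<in> ?C" "u \<noteq> v" "adj w u" "adj w v"
    then show "w \<in> ?C" by (rule closed)
  qed
qed auto

text \<open>The gate is unique: of two gates, each would be one step farther from \<open>a\<close>
  than the other. In a clique the usual gate equation takes this simple form, all distances inside
  the clique being 1.\<close>

definition gate :: "'a set \<Rightarrow> 'a \<Rightarrow> 'a \<Rightarrow> bool" where
  "gate C a g \<longleftrightarrow> g \<in> C \<and> (\<forall>z\<in>C. z \<noteq> g \<longrightarrow> d z a = d g a + 1)"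

text \<open>If a nearest vertex \<open>g\<close> of \<open>C\<close> were tied with another vertex
  \<open>z\<close>, the triangle condition would give a closer common neighbour of both, which lies
  in \<open>C\<close> by closedness.\<close>

lemma ex_clique_gate:
  assumes C: "closed_clique C" and "a \<in> V"
  obtains g where "gate C a g"
proof -
  obtain c where "c \<in> C" using closed_cliqueD(2)[OF C] by blast
  then have "\<exists>g. g \<in> C \<and> (\<forall>z. z \<in> C \<longrightarrow> d g a \<le> d z a)"
    by (rule ex_has_least_nat)
  then obtain g where g: "g \<in> C" "\<And>z. z \<in> C \<Longrightarrow> d g a \<le> d z a"
    by auto
  have "d z a = d g a + 1" if z: "z \<in> C" "z \<noteq> g" for z
  proof (rule ccontr)
    assume neq: "d z a \<noteq> d g a + 1"
    have "adj g z" using closed_cliqueD(3)[OF C g(1) z(1)] z(2) by blast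
    then have "d a g = d a z"
      using dist_adj[OF \<open>a \<in> V\<close> \<open>adj g z\<close>] neq g(2)[OF z(1)] by (simp add: dist_commute)
    then obtain w where w: "adj g w" "adj z w" "d a w + 1 = d a g"
      using triangle[OF \<open>a \<in> V\<close> \<open>adj g z\<close>] by blast
    then have "w \<in> C"
      using closed_cliqueD(4)[OF C g(1) z(1)] z(2) adj_commute by blast
    with g(2)[of w] w show False by (simp add: dist_commute)
  qed
  then show thesis
    using that g(1) by (auto simp: gate_def)
qed

lemma gate_adj_dist:
  assumes "adj a b" and "closed_clique C" "gate C a y" "gate C b z" "y \<noteq> z"
  shows "d y b = d y a + 1" "d z b = d y a" "d z a = d y a + 1"
proof -
  have V: "y \<in> V" "z \<in> V"
    using assms closed_cliqueD(1)[OF assms(2)] by (auto simp: gate_def)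
  have "d z a = d y a + 1" "d y b = d z b + 1"
    using assms by (auto simp: gate_def)
  moreover have "d z a \<le> d z b + 1" "d y b \<le> d y a + 1"
    using dist_adj V assms by blast+
  ultimately show "d y b = d y a + 1" "d z b = d y a" "d z a = d y a + 1"
    by auto
qed

section \<open>Separation by gates is invariant under triangles and squares\<close>

definition separates :: "'a set \<Rightarrow> 'a \<Rightarrow> 'a \<Rightarrow> bool" where
  "separates C a b \<longleftrightarrow> (\<exists>y z. gate C a y \<and> gate C b z \<and> y \<noteq> z)"

lemma separates_commute: "separates C a b \<longleftrightarrow> separates C b a"
  by (auto simp: separates_def)

text \<open>If \<open>c\<close> shared the gate \<open>y\<close> of \<open>a\<close>, then seen from
  \<open>y\<close> both \<open>a\<close> and \<open>c\<close> would be closer neighbours of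
  \<open>b\<close>, and such neighbours are not adjacent.\<close>

lemma separates_triangle:
  assumes C: "closed_clique C" and "adj a b" "adj b c" "adj a c" "separates C a b"
  shows "separates C a c"
proof (rule ccontr)
  assume no: "\<not> separates C a c"
  have V: "c \<in> V" using assms adjD by blast
  obtain y z where yz: "gate C a y" "gate C b z" "y \<noteq> z"
    using assms by (auto simp: separates_def)
  obtain u where "gate C c u" using ex_clique_gate[OF C V] .
  with no yz have "gate C c y"
    by (auto simp: separates_def)
  have "y \<in> V" using yz closed_cliqueD(1)[OF C] by (auto simp: gate_def)
  have "d y b = d y a + 1" "d y b = d y c + 1"
    using gate_adj_dist(1)[OF \<open>adj a b\<close> C yz] gate_adj_dist(1)[OF _ C \<open>gate C c y\<close> yz(2,3)]
      \<open>adj b c\<close> by (auto simp: adj_commute)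
  then have "\<not> adj a c"
    using closer_neighbours_nonadj[OF \<open>y \<in> V\<close>, of b a c] assms by (auto simp: adj_commute)
  with assms show False by blast
qed

lemma gates_square_aux:
  assumes C: "closed_clique C"
    and "adj a b" "adj b c" "adj c e" "adj e a" "a \<noteq> c" "b \<noteq> e" "\<not> adj a c" "\<not> adj b e"
    and g: "gate C a y" "gate C b z" "gate C c u" "gate C e u" "y \<noteq> z" "u \<noteq> z"
  shows False
proof -
  have V: "y \<in> V" "z \<in> V" using g closed_cliqueD(1)[OF C] by (auto simp: gate_def)
  have ab: "d y b = d y a + 1" "d z b = d y a" "d z a = d y a + 1"
    using gate_adj_dist[OF \<open>adj a b\<close> C g(1,2,5)] .
  have cb: "d u b = d u c + 1" "d z b = d u c" "d z c = d u c + 1"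
    using gate_adj_dist[OF _ C g(3,2,6)] \<open>adj b c\<close>[unfolded adj_commute[of b c]] by blast+
  show False
  proof (cases "u = y")
    case True
    \<comment> \<open>Seen from \<open>y\<close> the top of the square is \<open>b\<close>, seen
      from \<open>z\<close> it is \<open>a\<close>. Applying \<open>square_top\<close> from both
      gates contradicts the value of \<open>d z c\<close> given by the gate of
      \<open>c\<close>.\<close>
    have "d y e + 2 = d y b"
      using square_top[OF V(1), of b a c e] assms ab cb True by (auto simp: adj_commute)
    moreover have "d z e = d y e + 1"
      using g True by (auto simp: gate_def)
    moreover have "d z c + 2 = d z a"
      by (rule square_top[OF V(2), of a b e c]) (use assms ab cb True calculation in \<open>auto simp: adj_commute\<close>)
    ultimately show False
      using ab cb True by simp
  next
    case False
    \<comment> \<open>With three different gates, all corners other than \<open>a\<close> are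
      exactly one step farther from \<open>y\<close> than \<open>a\<close> is, which is the
      configuration excluded by \<open>no_square_single_bottom\<close>.\<close>
    have "d u e = d y a" "d y e = d y a + 1"
      using gate_adj_dist[OF _ C g(1,4)] False \<open>adj e a\<close> g by (auto simp: gate_def adj_commute)
    moreover have "d y c = d y a + 1"
      using g False ab cb by (auto simp: gate_def)
    ultimately show False
      using no_square_single_bottom[OF V(1), of a b e c] assms ab by (auto simp: adj_commute)
  qed
qed

text \<open>Squares in the hyperplane relation may have chords, and a chord reduces the claim to two
  triangles. Otherwise a common gate \<open>u\<close> of \<open>c\<close> and \<open>e\<close>
  differs from \<open>y\<close> or from \<open>z\<close>, and \<open>gates_square_aux\<close>
  applies to the square or to its mirror image.\<close>

lemma separates_square:
  assumes C: "closed_clique C"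
    and "adj a b" "adj b c" "adj c e" "adj e a" "a \<noteq> c" "b \<noteq> e" and sep: "separates C a b"
  shows "separates C c e"
proof (cases "adj a c \<or> adj b e")
  case True
  then show ?thesis
  proof
    assume "adj a c"
    then have "separates C c a"
      using separates_triangle[OF C, of a b c] assms separates_commute by blast
    then show ?thesis
      using separates_triangle[OF C, of c a e] assms \<open>adj a c\<close> by (auto simp: adj_commute)
  next
    assume "adj b e"
    then have "separates C e b"
      using separates_triangle[OF C, of b a e] assms separates_commute by (auto simp: adj_commute)
    then show ?thesis
      using separates_triangle[OF C, of e b c] assms \<open>adj b e\<close> adj_commute separates_commute by blast
  qed
next
  case False
  show ?thesis
  proof (rule ccontr)
    assume no: "\<not> separates C c e"
    obtain y z where yz: "gate C a y" "gate C b z" "y \<noteq> z"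
      using sep by (auto simp: separates_def)
    obtain u where u: "gate C c u"
      using ex_clique_gate[OF C] adjD \<open>adj b c\<close> by metis
    obtain u' where "gate C e u'"
      using ex_clique_gate[OF C] adjD \<open>adj c e\<close> by metis
    with no u have ue: "gate C e u"
      by (auto simp: separates_def)
    show False
    proof (cases "u = z")
      case False
      then show False
        using gates_square_aux[OF C, of a b c e y z u] assms yz u ue \<open>\<not> (adj a c \<or> adj b e)\<close> by blast
    next
      case True
      then show False
        using gates_square_aux[OF C, of b a e c z y u] assms yz u ue \<open>\<not> (adj a c \<or> adj b e)\<close> adj_commute by metis
    qed
  qed
qed

end

section \<open>Carriers of hyperplanes\<close>

lemma sym_hyperplane_rel: "sym (hyperplane_rel E)"
proof -
  have "opposite_in_square E f e" if sq: "opposite_in_square E e f" for e f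
  proof -
    from sq obtain a b c d where "distinct [a, b, c, d]" "{{a, b}, {b, c}, {c, d}, {d, a}} \<subseteq> E"
      "e = {a, b}" "f = {c, d}"
      unfolding opposite_in_square_def by blast
    then have "distinct [c, d, a, b] \<and> {{c, d}, {d, a}, {a, b}, {b, c}} \<subseteq> E \<and> f = {c, d} \<and> e = {a, b}"
      by auto
    then show ?thesis
      unfolding opposite_in_square_def by blast
  qed
  moreover have "in_common_triangle E f e" if "in_common_triangle E e f" for e f
    using that unfolding in_common_triangle_def by blast
  ultimately have "sym {(e, f). in_common_triangle E e f \<or> opposite_in_square E e f}"
    unfolding sym_def by blast
  then show ?thesis
    unfolding hyperplane_rel_def by (rule sym_rtrancl)
qed

lemma trans_hyperplane_rel: "trans (hyperplane_rel E)"
  unfolding hyperplane_rel_def by (rule trans_rtrancl)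

lemma hyperplane_rel_edge:
  assumes "(e, f) \<in> hyperplane_rel E" "e \<in> E"
  shows "f \<in> E"
  using assms unfolding hyperplane_rel_def
proof (induction rule: rtrancl_induct)
  case (step f g)
  then show ?case
    by (auto simp: in_common_triangle_def opposite_in_square_def)
qed

definition hyperplane_of :: "'a set set \<Rightarrow> 'a set \<Rightarrow> 'a set set" where
  "hyperplane_of E e = hyperplane_rel E `` {e}"

lemma hyperplane_of_in_hyperplanes: "e \<in> E \<Longrightarrow> hyperplane_of E e \<in> hyperplanes E"
  unfolding hyperplanes_def hyperplane_of_def by (rule quotientI)

lemma in_hyperplane_of: "e \<in> hyperplane_of E e"
  by (simp add: hyperplane_of_def hyperplane_rel_def)

lemma hyperplane_memberD:
  assumes "J \<in> hyperplanes E" "e \<in> J"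
  shows "e \<in> E" "J = hyperplane_of E e"
proof -
  obtain e0 where e0: "e0 \<in> E" "J = hyperplane_rel E `` {e0}"
    using assms(1) unfolding hyperplanes_def by (rule quotientE)
  then have rel: "(e0, e) \<in> hyperplane_rel E"
    using assms(2) by blast
  then show "e \<in> E"
    using hyperplane_rel_edge e0(1) by blast
  have "(e, e0) \<in> hyperplane_rel E"
    using rel sym_hyperplane_rel by (metis symD)
  with rel show "J = hyperplane_of E e"
    unfolding e0(2) hyperplane_of_def using trans_hyperplane_rel by (auto dest: transD)
qed

lemma hyperplane_closed:
  assumes "J \<in> hyperplanes E" "e \<in> J" "(e, f) \<in> hyperplane_rel E"
  shows "f \<in> J"
  using assms(3) by (subst hyperplane_memberD(2)[OF assms(1,2)]) (simp add: hyperplane_of_def)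

context quasi_median
begin

lemma hyperplane_edge: "J \<in> hyperplanes E \<Longrightarrow> {x, y} \<in> J \<Longrightarrow> adj x y"
  using hyperplane_memberD(1) by (auto simp: adj_def)

lemma hyperplane_triangle:
  assumes J: "J \<in> hyperplanes E" "{a, b} \<in> J" and "adj b c" "adj a c"
  shows "{a, c} \<in> J"
proof -
  have "adj a b" using hyperplane_edge[OF J] .
  then have "distinct [a, b, c]" "{{a, b}, {b, c}, {a, c}} \<subseteq> E"
    using assms adjD by (auto simp: adj_def)
  then have "in_common_triangle E {a, b} {a, c}"
    unfolding in_common_triangle_def by blast
  then show ?thesis
    using hyperplane_closed[OF J] by (auto simp: hyperplane_rel_def)
qed

lemma hyperplane_square:
  assumes J: "J \<in> hyperplanes E" "{a, b} \<in> J" and "adj b c" "adj c e" "adj e a" "a \<noteq> c" "b \<noteq> e"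
  shows "{c, e} \<in> J"
proof -
  have "adj a b" using hyperplane_edge[OF J] .
  then have "distinct [a, b, c, e]" "{{a, b}, {b, c}, {c, e}, {e, a}} \<subseteq> E"
    using assms adjD(3)[of a b] adjD(3)[of b c] adjD(3)[of c e] adjD(3)[of e a] by (auto simp: adj_def)
  then have "opposite_in_square E {a, b} {c, e}"
    unfolding opposite_in_square_def by blast
  then show ?thesis
    using hyperplane_closed[OF J] by (auto simp: hyperplane_rel_def)
qed

lemma carrier_vertexE:
  assumes "J \<in> hyperplanes E" "x \<in> \<Union>J"
  obtains v where "{x, v} \<in> J" "adj x v"
proof -
  obtain e where e: "e \<in> J" "x \<in> e" using assms by blast
  obtain u v where "e = {u, v}"
    using hyperplane_memberD(1)[OF assms(1) e(1)] simple unfolding simple_graph_def by blast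
  with e have "{x, u} \<in> J \<or> {x, v} \<in> J"
    by (auto simp: insert_commute)
  then show thesis
    using that hyperplane_edge[OF assms(1)] by blast
qed

lemma separates_hyperplane_rel:
  assumes C: "closed_clique C"
    and "(e, f) \<in> hyperplane_rel E" "e = {a, b}" "separates C a b"
  shows "f = {u, v} \<Longrightarrow> separates C u v"
proof -
  \<comment> \<open>Hyperplanes contain unordered edges; symmetry of \<open>separates\<close> makes
    this predicate on edges independent of the naming of the two ends, so it can be carried through
    the induction.\<close>
  define sep where "sep e \<longleftrightarrow> (\<exists>a b. e = {a, b} \<and> separates C a b)" for e
  have sep_iff: "sep {a, b} \<longleftrightarrow> separates C a b" for a b
    using separates_commute by (auto simp: sep_def doubleton_eq_iff)
  have "sep f"
    using assms(2) unfolding hyperplane_rel_def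
  proof (induction rule: rtrancl_induct)
    case base
    then show ?case using assms by (auto simp: sep_def)
  next
    case (step f g)
    from step(2) consider "in_common_triangle E f g" | "opposite_in_square E f g" by blast
    then show ?case
    proof cases
      case 1
      then obtain x y z where xyz: "adj x y" "adj y z" "adj x z"
        and f: "f \<in> {{x, y}, {y, z}, {x, z}}" and g: "g \<in> {{x, y}, {y, z}, {x, z}}"
        unfolding in_common_triangle_def adj_def by auto
      have adj': "adj y x" "adj z y" "adj z x"
        using xyz by (simp_all add: adj_commute)
      note tri = separates_triangle[OF C]
      have "separates C x y \<and> separates C y z \<and> separates C x z"
        using f step(3)
      proof (elim insertE)
        assume "f = {x, y}" "sep f"
        then have "separates C x y" by (simp add: sep_iff)
        then show ?thesis
          using tri[of x y z] tri[of y x z] xyz adj' by (simp add: separates_commute)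
      next
        assume "f = {y, z}" "sep f"
        then have "separates C y z" by (simp add: sep_iff)
        then show ?thesis
          using tri[of y z x] tri[of z y x] xyz adj' by (simp add: separates_commute)
      next
        assume "f = {x, z}" "sep f"
        then have "separates C x z" by (simp add: sep_iff)
        then show ?thesis
          using tri[of x z y] tri[of z x y] xyz adj' by (simp add: separates_commute)
      qed simp
      with g show ?thesis by (auto simp: sep_iff)
    next
      case 2
      then obtain x y z w where sq: "adj x y" "adj y z" "adj z w" "adj w x" "x \<noteq> z" "y \<noteq> w"
        and fg: "f = {x, y}" "g = {z, w}"
        unfolding opposite_in_square_def adj_def by auto
      with step(3) have "separates C x y" by (simp add: sep_iff)
      then have "separates C z w"
        using separates_square[OF C sq] by blast
      with fg show ?thesis by (simp add: sep_iff)
    qed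
  qed
  then show "f = {u, v} \<Longrightarrow> separates C u v"
    by (simp add: sep_iff)
qed

lemma gate_self:
  assumes C: "closed_clique C" and "y \<in> C"
  shows "gate C y y"
  unfolding gate_def
proof (intro conjI ballI impI)
  fix z assume z: "z \<in> C" "z \<noteq> y"
  then have "adj z y"
    using closed_cliqueD(3)[OF C _ \<open>y \<in> C\<close>] by blast
  then show "d z y = d y y + 1"
    using adj_iff_dist[of z y] adjD(1,2)[of z y] by simp
qed fact

text \<open>A clique containing an edge of \<open>J\<close> at \<open>y\<close> separates the two
  ends of that edge, as each is its own gate; the invariance carries this over to every edge of
  \<open>J\<close>.\<close>

lemma carrier_clique:
  assumes J: "J \<in> hyperplanes E" and "y \<in> \<Union>J"
  obtains C where "closed_clique C" "y \<in> C" "\<And>u v. {u, v} \<in> J \<Longrightarrow> separates C u v"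
proof -
  obtain z where z: "{y, z} \<in> J" "adj y z"
    using carrier_vertexE[OF assms] .
  obtain C where C: "closed_clique C" "y \<in> C" "z \<in> C"
    using edge_in_closed_clique[OF z(2)] .
  have "separates C y z"
    using gate_self[OF C(1)] C adjD(3)[OF z(2)] by (auto simp: separates_def)
  moreover have "({y, z}, {u, v}) \<in> hyperplane_rel E" if "{u, v} \<in> J" for u v
    using that hyperplane_memberD(2)[OF J z(1)] by (simp add: hyperplane_of_def)
  ultimately have "separates C u v" if "{u, v} \<in> J" for u v
    using that separates_hyperplane_rel[OF C(1) _ refl] by blast
  with that C show thesis by blast
qed

text \<open>If \<open>y\<close> were not the gate of \<open>x\<close>, the gate equations would make
  \<open>v\<close> at most as far from \<open>y\<close> as \<open>x\<close> is.\<close>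

lemma gate_of_closer_end:
  assumes C: "closed_clique C" and "y \<in> C" "adj x v" "separates C x v" "d y v = d y x + 1"
  obtains z where "gate C x y" "gate C v z" "z \<in> C" "z \<noteq> y" "d z v = d y x" "d z x = d y x + 1"
proof -
  obtain g z where g: "gate C x g" "gate C v z" "g \<noteq> z"
    using assms by (auto simp: separates_def)
  note dist = gate_adj_dist[OF \<open>adj x v\<close> C g]
  have "g = y"
  proof (rule ccontr)
    assume "g \<noteq> y"
    then have "d y x = d g x + 1"
      using g(1) \<open>y \<in> C\<close> by (auto simp: gate_def)
    moreover have "d y v = d z v + 1 \<or> y = z"
      using g(2) \<open>y \<in> C\<close> by (auto simp: gate_def)
    ultimately show False
      using dist assms by auto
  qed
  with that[of z] g dist show thesis
    by (auto simp: gate_def)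
qed

section \<open>Carriers are closed under geodesic steps and triangles\<close>

lemma carrier_convex:
  assumes J: "J \<in> hyperplanes E" and x: "x \<in> \<Union>J" and y: "y \<in> \<Union>J"
    and q: "adj x q" "d y q + 1 = d y x"
  shows "q \<in> \<Union>J"
proof -
  obtain v where v: "{x, v} \<in> J" "adj x v"
    using carrier_vertexE[OF J x] .
  have "y \<in> V"
    using carrier_vertexE[OF J y] adjD(1) by blast
  \<comment> \<open>If an edge of \<open>J\<close> at \<open>x\<close> also points towards
    \<open>y\<close>, the quadrangle condition completes a square whose edge opposite to it ends at
    \<open>q\<close>.\<close>
  have down: "q \<in> \<Union>J" if u: "{x, u} \<in> J" "adj x u" "d y u + 1 = d y x" for u
  proof (cases "u = q")
    case True
    with u show ?thesis by blast
  next
    case False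
    then obtain w where w: "adj u w" "adj q w" "d y w + 2 = d y x"
      using quadrangle[OF \<open>y \<in> V\<close> u(2) q(1) u(3) q(2)] by blast
    have "{w, q} \<in> J"
      by (rule hyperplane_square[OF J u(1)]) (use w q False in \<open>auto simp: adj_commute\<close>)
    then show ?thesis by blast
  qed
  consider "d y v + 1 = d y x" | "d y v = d y x" | "d y v = d y x + 1"
    using dist_adj[OF \<open>y \<in> V\<close> v(2)] by linarith
  then show ?thesis
  proof cases
    case 1
    then show ?thesis using down v by blast
  next
    case 2
    then obtain w where w: "adj x w" "adj v w" "d y w + 1 = d y x"
      using triangle[OF \<open>y \<in> V\<close> v(2)] by auto
    have "{x, w} \<in> J"
      using hyperplane_triangle[OF J v(1) w(2,1)] .
    then show ?thesis using down w by blast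
  next
    case 3
    obtain C where C: "closed_clique C" "y \<in> C" "separates C x v"
      using carrier_clique[OF J y] v(1) by metis
    obtain z where z: "z \<in> C" "z \<noteq> y" "d z v = d y x" "d z x = d y x + 1"
      using gate_of_closer_end[OF C(1,2) v(2) C(3) 3] by blast
    have V: "z \<in> V" "q \<in> V"
      using closed_cliqueD(1)[OF C(1)] z(1) adjD(2)[OF q(1)] by auto
    have "adj z y"
      using closed_cliqueD(3)[OF C(1) z(1) C(2) z(2)] .
    then have "d z y = 1"
      using adj_iff_dist V \<open>y \<in> V\<close> by blast
    \<comment> \<open>Replacing \<open>y\<close> by \<open>z\<close> makes both \<open>v\<close> and
      \<open>q\<close> closer than \<open>x\<close>, so a square with sides {x, v} and {x, q} exists
      again.\<close>
    then have "d z q = d y x"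
      using dist_triangle[OF V(1) \<open>y \<in> V\<close> V(2)] dist_adj(1)[OF V(1) q(1)] q(2) z(4) by simp
    moreover have "v \<noteq> q" using 3 q(2) by auto
    ultimately obtain w where w: "adj v w" "adj q w" "d z w + 2 = d z x"
      using quadrangle[OF V(1) v(2) q(1)] z by metis
    have "{w, q} \<in> J"
      by (rule hyperplane_square[OF J v(1)]) (use w q \<open>v \<noteq> q\<close> in \<open>auto simp: adj_commute\<close>)
    then show ?thesis by blast
  qed
qed

text \<open>In the main case \<open>v\<close> is neither \<open>y\<close> nor adjacent to it. The
  gates give a square on \<open>x\<close>, \<open>y\<close>, \<open>z\<close>, \<open>v\<close>;
  seen from \<open>w\<close>, the vertices \<open>z\<close> and \<open>v\<close> are both at
  distance 2, and the triangle condition completes a prism with third edge from \<open>w\<close> to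
  \<open>s\<close>, parallel to {x, v}.\<close>

lemma carrier_triangle_closed:
  assumes J: "J \<in> hyperplanes E" and x: "x \<in> \<Union>J" and y: "y \<in> \<Union>J"
    and w: "adj x y" "adj w x" "adj w y"
  shows "w \<in> \<Union>J"
proof -
  obtain v where v: "{x, v} \<in> J" "adj x v"
    using carrier_vertexE[OF J x] .
  have sym: "adj y x" "adj x w" "adj y w" "adj v x"
    using w v(2) by (simp_all add: adj_commute)
  have easy: "w \<in> \<Union>J" if "{x, y} \<in> J"
    using hyperplane_triangle[OF J that sym(3,2)] by blast
  show ?thesis
  proof (cases "v = y \<or> adj v y")
    case True
    then have "{x, y} \<in> J"
      using v hyperplane_triangle[OF J v(1) _ w(1)] by blast
    then show ?thesis by (rule easy)
  next
    case False
    then have "\<not> adj y v" "v \<noteq> y" by (simp_all add: adj_commute)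
    have V: "y \<in> V" "x \<in> V" "w \<in> V"
      using adjD w by blast+
    have yx: "d y x = 1"
      using adj_iff_dist V sym(1) by blast
    have "d y v = 2"
      using common_neighbour_dist2[OF sym(1) v(2)] \<open>\<not> adj y v\<close> \<open>v \<noteq> y\<close> by blast
    then have yv: "d y v = d y x + 1"
      using yx by simp
    obtain C where C: "closed_clique C" "y \<in> C" "separates C x v"
      using carrier_clique[OF J y] v(1) by metis
    obtain z where z': "z \<in> C" "z \<noteq> y" "d z v = d y x" "d z x = d y x + 1"
      using gate_of_closer_end[OF C(1,2) v(2) C(3) yv] by blast
    then have z: "z \<in> C" "z \<noteq> y" "d z v = 1" "d z x = 2"
      using yx by simp_all
    have "z \<in> V"
      using closed_cliqueD(1)[OF C(1)] z(1) by auto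
    have "adj z y"
      using closed_cliqueD(3)[OF C(1) z(1) C(2) z(2)] .
    have "adj z v"
      using adj_iff_dist[of z v] \<open>z \<in> V\<close> z(3) adjD(2)[OF v(2)] by simp
    have nzx: "\<not> adj z x" "z \<noteq> x"
      using adj_iff_dist[of z x] \<open>z \<in> V\<close> V z(4) by auto
    have "\<not> adj w v"
      using K4_minus_edge[of v x w y] v(2) w sym False by (auto simp: adj_commute)
    have "\<not> adj w z"
      using K4_minus_edge[of z y w x] \<open>adj z y\<close> w sym nzx by (auto simp: adj_commute)
    have "w \<noteq> v" "w \<noteq> z"
      using w False nzx by auto
    have "d w v = 2" "d w z = 2"
      using common_neighbour_dist2[of w x v] common_neighbour_dist2[of w y z]
        w v(2) \<open>adj z y\<close> \<open>\<not> adj w v\<close> \<open>\<not> adj w z\<close> \<open>w \<noteq> v\<close> \<open>w \<noteq> z\<close> by (auto simp: adj_commute)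
    then obtain s where s: "adj v s" "adj z s" "d w s + 1 = 2"
      using triangle[OF V(3), of v z] \<open>adj z v\<close> by (auto simp: adj_commute)
    have "adj s w"
      using adj_iff_dist[of w s] V(3) adjD(2)[OF s(1)] s(3) by (simp add: adj_commute)
    moreover have "x \<noteq> s"
      using s nzx by blast
    ultimately have "{s, w} \<in> J"
      using hyperplane_square[OF J v(1) s(1)] w(2) \<open>w \<noteq> v\<close> by blast
    then show ?thesis by blast
  qed
qed

section \<open>From local convexity to gates and the Helly property\<close>

definition triangle_convex :: "'a set \<Rightarrow> bool" where
  "triangle_convex N \<longleftrightarrow> N \<subseteq> V \<and>
     (\<forall>x\<in>N. \<forall>y\<in>N. \<forall>q. adj x q \<longrightarrow> d y q + 1 = d y x \<longrightarrow> q \<in> N) \<and>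
     (\<forall>x\<in>N. \<forall>y\<in>N. \<forall>w. adj x y \<longrightarrow> adj w x \<longrightarrow> adj w y \<longrightarrow> w \<in> N)"

lemma triangle_convexD:
  assumes "triangle_convex N"
  shows "x \<in> N \<Longrightarrow> x \<in> V"
    and "x \<in> N \<Longrightarrow> y \<in> N \<Longrightarrow> adj x q \<Longrightarrow> d y q + 1 = d y x \<Longrightarrow> q \<in> N"
    and "x \<in> N \<Longrightarrow> y \<in> N \<Longrightarrow> adj x y \<Longrightarrow> adj w x \<Longrightarrow> adj w y \<Longrightarrow> w \<in> N"
proof -
  note * = assms[unfolded triangle_convex_def]
  show "x \<in> N \<Longrightarrow> x \<in> V"
    using *[THEN conjunct1] by blast
  show "x \<in> N \<Longrightarrow> y \<in> N \<Longrightarrow> adj x q \<Longrightarrow> d y q + 1 = d y x \<Longrightarrow> q \<in> N"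
    by (rule *[THEN conjunct2, THEN conjunct1, rule_format])
  show "x \<in> N \<Longrightarrow> y \<in> N \<Longrightarrow> adj x y \<Longrightarrow> adj w x \<Longrightarrow> adj w y \<Longrightarrow> w \<in> N"
    by (rule *[THEN conjunct2, THEN conjunct2, rule_format])
qed

text \<open>A step from \<open>x\<close> towards \<open>p\<close> is also a step towards
  \<open>y\<close>, because \<open>p\<close> lies on a geodesic; so the walk to \<open>p\<close>
  never leaves \<open>N\<close>.\<close>

lemma triangle_convex_interval:
  assumes N: "triangle_convex N" "x \<in> N" "y \<in> N" and "p \<in> V" "d y p + d p x = d y x"
  shows "p \<in> N"
  using \<open>x \<in> N\<close> \<open>d y p + d p x = d y x\<close>
proof (induction "d p x" arbitrary: x)
  case 0
  then show ?case
    using dist_eq_0[OF \<open>p \<in> V\<close> triangle_convexD(1)[OF N(1)]] by auto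
next
  case (Suc n)
  have V: "x \<in> V" "y \<in> V"
    using triangle_convexD(1)[OF N(1)] Suc.prems N by auto
  have "p \<noteq> x" using Suc.hyps(2) by auto
  then obtain q where q: "q \<in> V" "adj x q" "d p q + 1 = d p x"
    using ex_closer_neighbour[OF \<open>p \<in> V\<close> V(1)] by blast
  have "d y q \<le> d y p + d p q"
    by (rule dist_triangle[OF V(2) \<open>p \<in> V\<close> q(1)])
  then have "d y q + 1 = d y x" "d y p + d p q = d y q"
    using dist_adj(1)[OF V(2) q(2)] q(3) Suc.prems by auto
  moreover from this have "q \<in> N"
    using triangle_convexD(2)[OF N(1) Suc.prems(1) N(3) q(2)] by blast
  ultimately show ?case
    using Suc.hyps(1)[of q] Suc.hyps(2) q(3) by simp
qed

text \<open>The nearest vertex \<open>g\<close> is the gate. In the induction on the distance from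
  \<open>g\<close>, \<open>a\<close> precedes \<open>x\<close> on a geodesic from \<open>g\<close>,
  and it must be excluded that the distance from \<open>p\<close> drops or stalls on the step from
  \<open>a\<close> to \<open>x\<close>.\<close>

lemma triangle_convex_ex_gate:
  assumes N: "triangle_convex N" "N \<noteq> {}" and p: "p \<in> V"
  obtains g where "g \<in> N" "\<And>x. x \<in> N \<Longrightarrow> d p x = d p g + d g x"
proof -
  obtain c where "c \<in> N" using N by blast
  then have "\<exists>g. g \<in> N \<and> (\<forall>z. z \<in> N \<longrightarrow> d p g \<le> d p z)"
    by (rule ex_has_least_nat)
  then obtain g where g: "g \<in> N" "\<And>z. z \<in> N \<Longrightarrow> d p g \<le> d p z"
    by auto
  note inV = triangle_convexD(1)[OF N(1)]
  have "d p x = d p g + k" if "x \<in> N" "d g x = k" for k x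
    using that
  proof (induction k arbitrary: x rule: less_induct)
    case (less k)
    have V: "x \<in> V" "g \<in> V"
      using less.prems g(1) inV by auto
    show ?case
    proof (cases "x = g")
      case True
      with less.prems show ?thesis by simp
    next
      case False
      then obtain a where a: "a \<in> V" "adj x a" "d g a + 1 = d g x"
        using ex_closer_neighbour[OF V(2,1)] by metis
      have "a \<in> N"
        using triangle_convexD(2)[OF N(1) less.prems(1) g(1) a(2,3)] .
      have pa: "d p a + 1 = d p g + k"
        using less.IH[of "d g a" a] \<open>a \<in> N\<close> a(3) less.prems(2) by simp
      \<comment> \<open>Unless \<open>a = g\<close>, the quadrangle condition at \<open>a\<close>
        would give a vertex \<open>m\<close> of \<open>N\<close> at distance \<open>k - 1\<close>
        from \<open>g\<close> and two steps closer to \<open>p\<close> than \<open>a\<close>,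
        against the induction hypothesis.\<close>
      have no_drop: False if z: "z \<in> N" "adj z a" "d g z = k" "d p z + 1 = d p a" for z
      proof (cases "a = g")
        case True
        then show False using g(2)[OF z(1)] z(4) by simp
      next
        case False
        then obtain b where b: "b \<in> V" "adj a b" "d g b + 1 = d g a"
          using ex_closer_neighbour[OF V(2) a(1)] by metis
        have "b \<in> N"
          using triangle_convexD(2)[OF N(1) \<open>a \<in> N\<close> g(1) b(2,3)] .
        have "d p b + 1 = d p a"
          using less.IH[of "d g b" b] \<open>b \<in> N\<close> a(3) b(3) less.prems(2) pa by simp
        moreover have "b \<noteq> z"
          using a(3) b(3) less.prems(2) z(3) by auto
        moreover have "adj a z" using z(2) by (simp add: adj_commute)
        ultimately obtain m where m: "adj b m" "adj z m" "d p m + 2 = d p a"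
          using quadrangle[OF p b(2)] z(4) by metis
        have mV: "m \<in> V" "z \<in> V" using m adjD by blast+
        have "d g m + 1 = d g z"
          using dist_adj(2)[OF V(2) m(1)] dist_adj(1)[OF V(2) m(2)] a(3) b(3) less.prems(2) z(3) by simp
        then have "m \<in> N"
          using triangle_convexD(2)[OF N(1) z(1) g(1) m(2)] by blast
        then have "d p m = d p g + d g m"
          using less.IH[of "d g m" m] \<open>d g m + 1 = d g z\<close> z(3) by simp
        then show False
          using m(3) pa \<open>d g m + 1 = d g z\<close> z(3) by simp
      qed
      consider "d p x + 1 = d p a" | "d p x = d p a" | "d p x = d p a + 1"
        using dist_adj[OF p a(2)] by linarith
      then show ?thesis
      proof cases
        case 1
        then show ?thesis using no_drop[of x] less.prems a by simp
      next
        case 2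
        then obtain w where w: "adj x w" "adj a w" "d p w + 1 = d p x"
          using triangle[OF p a(2)] by auto
        have "adj w x" "adj w a" using w by (simp_all add: adj_commute)
        then have "w \<in> N"
          using triangle_convexD(3)[OF N(1) less.prems(1) \<open>a \<in> N\<close> a(2)] by blast
        \<comment> \<open>Otherwise \<open>w\<close> would be as far from \<open>g\<close> as
          \<open>a\<close>, and by induction also as far from \<open>p\<close>. So
          \<open>no_drop\<close> applies to \<open>w\<close> and excludes a stall.\<close>
        have "d g w = k"
        proof (rule ccontr)
          assume "d g w \<noteq> k"
          moreover have "d g w \<le> d g a + 1" "d g x \<le> d g w + 1"
            using dist_adj[OF V(2)] w by blast+
          ultimately have "d g w < k" "d g w = d g a"
            using a(3) less.prems(2) by auto
          then have "d p w = d p a"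
            using less.IH[of "d g w" w] \<open>w \<in> N\<close> a(3) less.prems(2) pa by simp
          then show False using w(3) 2 by simp
        qed
        then show ?thesis
          using no_drop[of w] \<open>w \<in> N\<close> \<open>adj w a\<close> w(3) 2 by simp
      next
        case 3
        then show ?thesis using pa by simp
      qed
    qed
  qed
  with that g(1) show thesis by blast
qed

definition common_carrier :: "'a set set set \<Rightarrow> 'a set" where
  "common_carrier \<sigma> = {x \<in> V. \<forall>J\<in>\<sigma>. x \<in> \<Union>J}"

lemma triangle_convex_common_carrier:
  assumes "\<sigma> \<subseteq> hyperplanes E"
  shows "triangle_convex (common_carrier \<sigma>)"
  unfolding triangle_convex_def
proof (intro conjI ballI allI impI)
  show "common_carrier \<sigma> \<subseteq> V" by (auto simp: common_carrier_def)
next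
  fix x y q assume *: "x \<in> common_carrier \<sigma>" "y \<in> common_carrier \<sigma>" "adj x q" "d y q + 1 = d y x"
  have "q \<in> \<Union>J" if "J \<in> \<sigma>" for J
  proof (rule carrier_convex)
    show "x \<in> \<Union>J" "y \<in> \<Union>J" "J \<in> hyperplanes E"
      using * that assms unfolding common_carrier_def by blast+
  qed fact+
  then show "q \<in> common_carrier \<sigma>"
    using adjD(2)[OF *(3)] unfolding common_carrier_def by blast
next
  fix x y w assume *: "x \<in> common_carrier \<sigma>" "y \<in> common_carrier \<sigma>" "adj x y" "adj w x" "adj w y"
  have "w \<in> \<Union>J" if "J \<in> \<sigma>" for J
  proof (rule carrier_triangle_closed)
    show "x \<in> \<Union>J" "y \<in> \<Union>J" "J \<in> hyperplanes E"
      using * that assms unfolding common_carrier_def by blast+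
  qed fact+
  then show "w \<in> common_carrier \<sigma>"
    using adjD(1)[OF *(4)] unfolding common_carrier_def by blast
qed

lemma carrier_subset_V: "J \<in> hyperplanes E \<Longrightarrow> \<Union>J \<subseteq> V"
  using carrier_vertexE adjD(1) by blast

text \<open>Let \<open>g\<close> be the gate in the carrier of \<open>J\<close> of a vertex
  \<open>x\<close> common to the other carriers. For each other \<open>K\<close>, \<open>g\<close>
  lies on a geodesic from \<open>x\<close> to a vertex \<open>z\<close> shared by both carriers,
  hence in the carrier of \<open>K\<close>.\<close>

lemma helly_carriers:
  assumes "finite \<sigma>" "\<sigma> \<noteq> {}" "\<sigma> \<subseteq> hyperplanes E"
    and "\<And>J K. J \<in> \<sigma> \<Longrightarrow> K \<in> \<sigma> \<Longrightarrow> \<Union>J \<inter> \<Union>K \<noteq> {}"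
  shows "common_carrier \<sigma> \<noteq> {}"
  using assms
proof (induction \<sigma> rule: finite_ne_induct)
  case (singleton J)
  then have "\<Union>J \<noteq> {}" by blast
  then show ?case
    using carrier_subset_V[of J] singleton by (auto simp: common_carrier_def)
next
  case (insert J \<sigma>)
  have "common_carrier \<sigma> \<noteq> {}"
  proof (rule insert.IH)
    show "\<sigma> \<subseteq> hyperplanes E"
      using insert.prems(1) by simp
    show "\<Union>J' \<inter> \<Union>K \<noteq> {}" if "J' \<in> \<sigma>" "K \<in> \<sigma>" for J' K
      using insert.prems(2)[of J' K] that by blast
  qed
  then obtain x where x: "x \<in> common_carrier \<sigma>" by blast
  have J: "J \<in> hyperplanes E" "\<Union>J \<noteq> {}"
    using insert.prems(1) insert.prems(2)[of J J] by simp_all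
  then have "common_carrier {J} \<noteq> {}"
    using carrier_subset_V[of J] by (auto simp: common_carrier_def)
  moreover have "x \<in> V" using x by (simp add: common_carrier_def)
  ultimately obtain g where g: "g \<in> common_carrier {J}" "\<And>z. z \<in> common_carrier {J} \<Longrightarrow> d x z = d x g + d g z"
    using triangle_convex_ex_gate[OF triangle_convex_common_carrier[of "{J}"]] J(1) by blast
  have "g \<in> \<Union>K" if K: "K \<in> \<sigma>" for K
  proof -
    have "K \<in> hyperplanes E" "\<Union>J \<inter> \<Union>K \<noteq> {}"
      using K insert.prems(1) insert.prems(2)[of J K] by auto
    then obtain z where z: "z \<in> \<Union>J" "z \<in> \<Union>K" by blast
    then have "z \<in> V" using carrier_subset_V J(1) by blast
    then have "z \<in> common_carrier {J}" "z \<in> common_carrier {K}"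
      using z by (simp_all add: common_carrier_def)
    moreover have "x \<in> common_carrier {K}"
      using x K by (simp add: common_carrier_def)
    moreover have "g \<in> V" using g(1) by (simp add: common_carrier_def)
    ultimately have "g \<in> common_carrier {K}"
      using triangle_convex_interval[OF triangle_convex_common_carrier[of "{K}"], of z x g] \<open>K \<in> hyperplanes E\<close> g(2) by simp
    then show ?thesis by (simp add: common_carrier_def)
  qed
  then have "g \<in> common_carrier (insert J \<sigma>)"
    using g(1) by (simp add: common_carrier_def)
  then show ?case by blast
qed

text \<open>A gate is the only vertex of the common carrier nearest to \<open>p\<close>. The
  presence of \<open>y\<close> shows that \<open>x\<close> is not the gate, and any step from
  \<open>x\<close> towards the gate is a step towards \<open>p\<close>.\<close>

lemma ex_lower_common_carrier:
  assumes \<sigma>: "\<sigma> \<subseteq> hyperplanes E" and "p \<in> V"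
    and x: "x \<in> common_carrier \<sigma>" and y: "y \<in> common_carrier \<sigma>" and "x \<noteq> y" "d p y \<le> d p x"
  obtains q where "q \<in> common_carrier \<sigma>" "adj x q" "d p q + 1 = d p x"
proof -
  note N = triangle_convex_common_carrier[OF \<sigma>]
  obtain g where g: "g \<in> common_carrier \<sigma>" "\<And>z. z \<in> common_carrier \<sigma> \<Longrightarrow> d p z = d p g + d g z"
    using triangle_convex_ex_gate[OF N _ \<open>p \<in> V\<close>] x by blast
  have V: "g \<in> V" "x \<in> V" "y \<in> V"
    using triangle_convexD(1)[OF N] g x y by auto
  have "g \<noteq> x"
  proof
    assume "g = x"
    then have "d x y = 0" using g(2)[OF y] \<open>d p y \<le> d p x\<close> by simp
    then show False using dist_eq_0[OF V(2,3)] \<open>x \<noteq> y\<close> by simp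
  qed
  then obtain q where q: "q \<in> V" "adj x q" "d g q + 1 = d g x"
    using ex_closer_neighbour[OF V(1,2)] by blast
  then have "q \<in> common_carrier \<sigma>"
    using triangle_convexD(2)[OF N x g(1)] by blast
  then show thesis
    using that q g(2)[of q] g(2)[OF x] by simp
qed

end

section \<open>Contractibility of the contact complex\<close>

context quasi_median
begin

lemma contractible_contact_complex:
  assumes o: "adj b b'"
  shows "contractible_space (geometric_realization (contact_complex E))"
proof -
  have "b \<in> V" using adjD(1)[OF o] .
  define M where "M = hyperplane_of E {b, b'}"
  define B where "B x = {J \<in> hyperplanes E. x \<in> \<Union>J}" for x
  \<comment> \<open>The index is shifted: \<open>L (Suc m)\<close> holds the simplices seen from
    within distance \<open>m\<close> of \<open>b\<close>. The seed \<open>L 0\<close> makes the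
    attachment of the simplex at \<open>b\<close> itself an attachment along a cone, with apex
    \<open>M\<close>.\<close>
  define L where "L n = (case n of 0 \<Rightarrow> {{M}}
      | Suc m \<Rightarrow> {\<sigma>. finite \<sigma> \<and> \<sigma> \<noteq> {} \<and> (\<exists>x\<in>V. d b x \<le> m \<and> \<sigma> \<subseteq> B x)})" for n
  define I where "I n = {x \<in> V. d b x = n}" for n
  obtain parent where parent: "adj x (parent x)" "d b (parent x) + 1 = d b x"
    if "x \<in> V" "x \<noteq> b" for x
  proof -
    have "\<forall>x. \<exists>q. x \<in> V \<longrightarrow> x \<noteq> b \<longrightarrow> adj x q \<and> d b q + 1 = d b x"
      using ex_closer_neighbour[OF \<open>b \<in> V\<close>] by metis
    then obtain f where "\<forall>x. x \<in> V \<longrightarrow> x \<noteq> b \<longrightarrow> adj x (f x) \<and> d b (f x) + 1 = d b x"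
      by (rule choice[THEN exE])
    with that[of f] show thesis by blast
  qed
  define a where "a x = (if x = b then M else hyperplane_of E {x, parent x})" for x
  have B_edge: "hyperplane_of E {x, y} \<in> B x" "hyperplane_of E {x, y} \<in> B y" if "adj x y" for x y
    using that hyperplane_of_in_hyperplanes[of "{x, y}" E] in_hyperplane_of[of "{x, y}" E]
    by (auto simp: B_def adj_def)
  have B_iff: "\<sigma> \<subseteq> B x \<longleftrightarrow> \<sigma> \<subseteq> hyperplanes E \<and> x \<in> common_carrier \<sigma>" if "x \<in> V" for \<sigma> x
    using that by (auto simp: B_def common_carrier_def)
  have lower: "\<exists>q. adj x q \<and> d b q + 1 = d b x \<and> \<sigma> \<subseteq> B q"
    if xy: "x \<in> V" "y \<in> V" "x \<noteq> y" "d b y \<le> d b x" "\<sigma> \<subseteq> B x" "\<sigma> \<subseteq> B y" for x y \<sigma>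
  proof -
    have \<sigma>: "\<sigma> \<subseteq> hyperplanes E" "x \<in> common_carrier \<sigma>" "y \<in> common_carrier \<sigma>"
      using xy(1,2,5,6) B_iff by blast+
    obtain q where "q \<in> common_carrier \<sigma>" "adj x q" "d b q + 1 = d b x"
      using ex_lower_common_carrier[OF \<sigma>(1) \<open>b \<in> V\<close> \<sigma>(2,3) xy(3,4)] by blast
    then show ?thesis
      using B_iff[OF adjD(2)] \<sigma>(1) by blast
  qed
  \<comment> \<open>For any other closer neighbour \<open>q\<close>, the quadrangle condition gives
    a square in which {w, q} is opposite to {x, parent x}, so the hyperplane chosen at
    \<open>x\<close> is also present at \<open>q\<close>.\<close>
  have apex_lower: "a x \<in> B q" if q: "adj x q" "d b q + 1 = d b x" for x q
  proof -
    have x: "x \<in> V" "x \<noteq> b"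
      using adjD(1)[OF q(1)] q(2) dist_self[of b] by auto
    show ?thesis
    proof (cases "q = parent x")
      case True
      then show ?thesis
        using B_edge(2)[OF q(1)] x by (simp add: a_def)
    next
      case False
      then obtain w where w: "adj q w" "adj (parent x) w" "d b w + 2 = d b x"
        using quadrangle[OF \<open>b \<in> V\<close> q(1) parent(1)[OF x] q(2) parent(2)[OF x]] by blast
      have "x \<noteq> w" using w(3) by auto
      have "a x \<in> hyperplanes E" "{x, parent x} \<in> a x"
        using x parent(1)[OF x] hyperplane_of_in_hyperplanes in_hyperplane_of
        by (auto simp: a_def adj_def)
      then have "{w, q} \<in> a x"
        using hyperplane_square[of "a x" x "parent x" w q] w q(1) False \<open>x \<noteq> w\<close>
        by (auto simp: adj_commute)
      with \<open>a x \<in> hyperplanes E\<close> show ?thesis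
        by (auto simp: B_def)
    qed
  qed
  have level0: "x = b" if "x \<in> V" "d b x = 0" for x
    using dist_eq_0[OF \<open>b \<in> V\<close> that(1)] that(2) by simp
  have "contractible_space (geometric_realization (\<Union>n. L n))"
  proof (rule contractible_space_cone_filtration[where I = I and B = B and a = a])
    show "L 0 = {{M}}" by (simp add: L_def)
  next
    fix n
    show "L (Suc n) = L n \<union> {\<sigma>. finite \<sigma> \<and> \<sigma> \<noteq> {} \<and> (\<exists>x\<in>I n. \<sigma> \<subseteq> B x)}"
    proof (cases n)
      case 0
      have "{M} \<subseteq> B b"
        using B_edge(1)[OF o] by (simp add: M_def)
      then have "{M} \<in> {\<sigma>. finite \<sigma> \<and> \<sigma> \<noteq> {} \<and> (\<exists>x\<in>V. d b x \<le> 0 \<and> \<sigma> \<subseteq> B x)}"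
        using \<open>b \<in> V\<close> by (auto intro!: bexI[of _ b])
      then show ?thesis
        using 0 by (auto simp: L_def I_def)
    next
      case (Suc m)
      then show ?thesis
        by (auto simp: L_def I_def le_Suc_eq)
    qed
  next
    fix n x assume x: "x \<in> I n"
    show "a x \<in> B x \<and> {a x} \<in> L n"
    proof (cases "x = b")
      case True
      then show ?thesis
        using x B_edge(1)[OF o] by (auto simp: I_def L_def a_def M_def)
    next
      case False
      with x have "x \<in> V" "d b x = n" by (auto simp: I_def)
      note p = parent[OF \<open>x \<in> V\<close> False]
      have "parent x \<in> V" using adjD(2)[OF p(1)] .
      moreover have "a x \<in> B (parent x)" using apex_lower[OF p] .
      ultimately have "{a x} \<in> L n"
        using p(2) \<open>d b x = n\<close> by (auto simp: L_def split: nat.split intro!: bexI[of _ "parent x"])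
      moreover have "a x \<in> B x"
        using B_edge(1)[OF p(1)] False by (simp add: a_def)
      ultimately show ?thesis by blast
    qed
  next
    fix n x \<sigma> assume x: "x \<in> I n" and \<sigma>: "\<sigma> \<in> L n" "\<sigma> \<subseteq> B x"
    show "insert (a x) \<sigma> \<in> L n"
    proof (cases n)
      case 0
      then have "x = b" using x level0 by (simp add: I_def)
      then show ?thesis using 0 \<sigma> by (simp add: L_def a_def)
    next
      case (Suc m)
      then obtain y where y: "y \<in> V" "d b y \<le> m" "\<sigma> \<subseteq> B y" "finite \<sigma>"
        using \<sigma>(1) by (auto simp: L_def)
      have "x \<in> V" "d b x = Suc m" using x Suc by (auto simp: I_def)
      moreover have "x \<noteq> y" using y(2) \<open>d b x = Suc m\<close> by auto
      ultimately obtain q where q: "adj x q" "d b q + 1 = d b x" "\<sigma> \<subseteq> B q"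
        using lower[of x y \<sigma>] y \<sigma>(2) by auto
      then have "insert (a x) \<sigma> \<subseteq> B q"
        using apex_lower by blast
      then show ?thesis
        using Suc q(2) y(4) \<open>d b x = Suc m\<close> adjD(2)[OF q(1)] by (auto simp: L_def intro!: bexI[of _ q])
    qed
  next
    fix n x y \<sigma>
    assume *: "x \<in> I n" "y \<in> I n" "x \<noteq> y" "finite \<sigma>" "\<sigma> \<noteq> {}" "\<sigma> \<subseteq> B x" "\<sigma> \<subseteq> B y"
    then obtain q where q: "adj x q" "d b q + 1 = n" "\<sigma> \<subseteq> B q"
      using lower[of x y \<sigma>] by (auto simp: I_def)
    then show "\<sigma> \<in> L n"
      using * adjD(2)[OF q(1)] by (auto simp: L_def split: nat.split intro!: bexI[of _ q])
  qed
  moreover have "(\<Union>n. L n) = contact_complex E"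
  proof (intro equalityI subsetI)
    fix \<sigma> assume "\<sigma> \<in> (\<Union>n. L n)"
    then obtain n where "\<sigma> \<in> L n" by blast
    then have "\<exists>x\<in>V. finite \<sigma> \<and> \<sigma> \<noteq> {} \<and> \<sigma> \<subseteq> B x"
      using B_edge(1)[OF o] \<open>b \<in> V\<close> by (auto simp: L_def M_def split: nat.splits)
    then show "\<sigma> \<in> contact_complex E"
      unfolding contact_complex_def in_contact_def B_def by blast
  next
    fix \<sigma> assume \<sigma>: "\<sigma> \<in> contact_complex E"
    then have fin: "finite \<sigma>" "\<sigma> \<noteq> {}" and hyp: "\<sigma> \<subseteq> hyperplanes E"
      by (auto simp: contact_complex_def)
    have "\<Union>J \<inter> \<Union>K \<noteq> {}" if JK: "J \<in> \<sigma>" "K \<in> \<sigma>" for J K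
    proof (cases "J = K")
      case True
      obtain e where "e \<in> E" "J = hyperplane_rel E `` {e}"
        using JK(1) hyp unfolding hyperplanes_def by (blast elim: quotientE)
      then have "e \<in> J"
        using in_hyperplane_of[of e E] by (simp add: hyperplane_of_def)
      moreover have "e \<noteq> {}"
        using \<open>e \<in> E\<close> simple unfolding simple_graph_def by blast
      ultimately show ?thesis using True by blast
    next
      case False
      then have "in_contact J K"
        using \<sigma> JK False by (simp add: contact_complex_def)
      then show ?thesis
        unfolding in_contact_def by blast
    qed
    \<comment> \<open>The Helly property turns pairwise contact into a single vertex at which all
      hyperplanes of \<open>\<sigma>\<close> have an edge; its distance from \<open>b\<close> names
      a stage containing \<open>\<sigma>\<close>.\<close>
    then have "common_carrier \<sigma> \<noteq> {}"
      using helly_carriers[OF fin hyp] by blast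
    then obtain x where "x \<in> V" "x \<in> common_carrier \<sigma>"
      by (auto simp: common_carrier_def)
    then have "\<sigma> \<in> L (Suc (d b x))"
      using fin hyp B_iff by (auto simp: L_def)
    then show "\<sigma> \<in> (\<Union>n. L n)" by blast
  qed
  ultimately show ?thesis by simp
qed

end

theorem proposition3p4:
  fixes V :: "'a set" and E :: "'a set set"
  assumes "quasi_median_graph V E"
  shows "contractible_space (geometric_realization (contact_complex E))"
proof -
  interpret quasi_median V E
    by unfold_locales fact
  show ?thesis
  proof (cases "E = {}")
    \<comment> \<open>Without edges there are no hyperplanes and the realization is empty;
      \<open>contractible_space\<close> holds for the empty space by convention.\<close>
    case True
    then have "contact_complex E = {}"
      by (auto simp: contact_complex_def hyperplanes_def quotient_def)
    then have "topspace (geometric_realization (contact_complex E)) = {}"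
      by (simp add: topspace_geometric_realization)
    then show ?thesis
      by (metis contractible_space_empty null_topspace_iff_trivial)
  next
    case False
    then obtain e where "e \<in> E" by blast
    moreover from this obtain x y where "e = {x, y}"
      using simple unfolding simple_graph_def by meson
    ultimately show ?thesis
      using contractible_contact_complex[of x y] by (simp add: adj_def)
  qed
qed

end
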